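(* In the random graph process (version 1) described in the context, almost surely as $n\to\infty$, the global clustering coefficient of the graph after $n$ steps converges to $1$, and the average clustering coefficient of the graph after $n$ steps converges to $1-c_0-c_1$, where $c_d$ ($d\ge0$) is the almost sure limit of the proportion of vertices of degree $d$.
   Context: Random graph process, version 1: the process starts (after $0$ steps) with the graph consisting of a single vertex and no edges. It evolves in discrete steps; one new vertex is born at each step, so there are $n+1$ vertices after $n$ steps. The graph is always simple. At each step, two (not necessarily different) old vertices $u,v$ (i.e. vertices already present before the step) are chosen independently of each other and of the past, each uniformly at random among all old vertices. Duplication part: the new vertex is added to the graph and connected by an edge to $u$ and to every neighbour of $u$. Deletion part: afterwards, all edges emanating from $v$ are deleted, except that edges incident to the new vertex are not deleted (so if $v$ is connected to the new vertex, that edge is kept). $X[n,d]$ denotes the number of vertices of degree $d$ after $n$ steps. For every $d\ge0$ the proportion $X[n,d]/(n+1)$ converges almost surely, as $n\to\infty$, to a deterministic positive number, denoted $c_d$; these numbers satisfy $c_0=\frac{1+c_1}{3}$ and $c_d=\frac{d+1}{2d+3}(c_{d-1}+c_{d+1})$ for $d\ge 1$. Clustering coefficients: the local clustering coefficient of a vertex of degree $d$ is the fraction of the $\binom d2$ pairs of its neighbours that are connected by an edge (defined to be $0$ when $d<2$). The average clustering coefficient of a graph is the average of the local clustering coefficients of all its vertices. The global clustering coefficient of a graph is $3$ times the number of triangles divided by the number of connected triplets (paths of length $2$). *)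

theory Defs
  imports "HOL-Probability.Probability"
begin

text \<open>
  A graph is given by a finite vertex set \<open>V\<close> and a set \<open>E\<close> of edges, each edge being
  a two-element set of vertices.
\<close>

definition neighbours :: "'v set set \<Rightarrow> 'v \<Rightarrow> 'v set" where
  "neighbours E x = {y. y \<noteq> x \<and> {x, y} \<in> E}"

definition degree :: "'v set set \<Rightarrow> 'v \<Rightarrow> nat" where
  "degree E x = card (neighbours E x)"

definition local_clustering :: "'v set set \<Rightarrow> 'v \<Rightarrow> real" where
  "local_clustering E x =
     (if degree E x < 2 then 0
      else real (card {P. P \<subseteq> neighbours E x \<and> card P = 2 \<and> P \<in> E})
             / real (degree E x choose 2))"

definition average_clustering :: "'v set \<Rightarrow> 'v set set \<Rightarrow> real" where
  "average_clustering V E = (\<Sum>x\<in>V. local_clustering E x) / real (card V)"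

definition triangles :: "'v set \<Rightarrow> 'v set set \<Rightarrow> 'v set set" where
  "triangles V E = {T. T \<subseteq> V \<and> card T = 3 \<and> (\<forall>x\<in>T. \<forall>y\<in>T. x \<noteq> y \<longrightarrow> {x, y} \<in> E)}"

text \<open>
  A path of length 2 is recorded as its middle vertex together with the unordered pair of its
  end vertices, so that a path and its reversal count once and a triangle contains three paths.
\<close>

definition connected_triplets :: "'v set \<Rightarrow> 'v set set \<Rightarrow> ('v \<times> 'v set) set" where
  "connected_triplets V E = {(x, P). x \<in> V \<and> P \<subseteq> neighbours E x \<and> card P = 2}"

text \<open>The value is 0 (division by zero) for a graph without connected triplets.\<close>

definition global_clustering :: "'v set \<Rightarrow> 'v set set \<Rightarrow> real" where
  "global_clustering V E =
     3 * real (card (triangles V E)) / real (card (connected_triplets V E))"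


definition duplicate :: "'v \<Rightarrow> 'v \<Rightarrow> 'v set set \<Rightarrow> 'v set set" where
  "duplicate w u E = E \<union> {{w, x} | x. x \<in> insert u (neighbours E u)}"

definition delete_edges :: "'v \<Rightarrow> 'v \<Rightarrow> 'v set set \<Rightarrow> 'v set set" where
  "delete_edges w v E = {e \<in> E. v \<in> e \<longrightarrow> w \<in> e}"

text \<open>
  The vertices after \<open>n\<close> steps are \<open>0, \<dots>, n\<close>, vertex \<open>k\<close> being born at step \<open>k\<close>.
  Step \<open>n + 1\<close> duplicates \<open>u n\<close> and then deletes the old edges at \<open>v n\<close>.
\<close>

primrec process_edges :: "(nat \<Rightarrow> nat) \<Rightarrow> (nat \<Rightarrow> nat) \<Rightarrow> nat \<Rightarrow> nat set set" where
  "process_edges u v 0 = {}"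
| "process_edges u v (Suc n) =
     delete_edges (Suc n) (v n) (duplicate (Suc n) (u n) (process_edges u v n))"

definition degree_count :: "(nat \<Rightarrow> nat) \<Rightarrow> (nat \<Rightarrow> nat) \<Rightarrow> nat \<Rightarrow> nat \<Rightarrow> nat" where
  "degree_count u v n d = card {x \<in> {..n}. degree (process_edges u v n) x = d}"

text \<open>
  The graph after \<open>n\<close> steps is a function of the first \<open>n\<close> pairs of choices, so independence
  of each choice from the past amounts to joint independence of all choices.
\<close>

locale uniform_choices = prob_space M
  for M :: "'a measure" and U V :: "nat \<Rightarrow> 'a \<Rightarrow> nat" +
  assumes indep_choices: "indep_vars (\<lambda>_. count_space UNIV) (case_sum U V) UNIV"
    and distr_U: "\<And>n. distr M (count_space UNIV) (U n) = measure_pmf (pmf_of_set {..n})"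
    and distr_V: "\<And>n. distr M (count_space UNIV) (V n) = measure_pmf (pmf_of_set {..n})"

end

theory Submission
  imports Defs "HOL-Real_Asymp.Real_Asymp"
begin

text \<open>
  Call a path \<open>y, x, z\<close> of length 2 whose ends are distinct and not adjacent an open triplet.
  Both clustering coefficients are governed by the number of open triplets: a vertex of degree at
  least 2 has local clustering coefficient 1 unless it is the centre of one, and the global
  coefficient is 1 minus the proportion of open triplets among all connected triplets. So the
  theorem reduces to two facts: almost surely there are only \<open>o(n)\<close> open triplets after \<open>n\<close>
  steps (\<open>AE_open_triplets_sublinear\<close>), and a positive proportion of the vertices has degree at
  least 2, that is \<open>c 0 + c 1 < 1\<close> (\<open>large_degree_limit_pos\<close>).

  The process keeps the graph close to a disjoint union of cliques for the following reason.
  Let \<open>o x\<close> be the number of open triplets in which the vertex \<open>x\<close> takes part. Duplicating \<open>u\<close>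
  creates one copy of every open triplet through \<open>u\<close>, and deleting the edges of \<open>v\<close> destroys all
  open triplets through \<open>v\<close>. Since \<open>u\<close> and \<open>v\<close> have the same distribution, the two effects cancel
  in expectation. The only other source of open triplets is the kept edge between \<open>v\<close> and the new
  vertex: if \<open>v\<close> is \<open>u\<close> or one of its neighbours, which has conditional probability
  \<open>(degree u + 1) / (n + 1)\<close>, at most \<open>2 * degree u\<close> new ones appear
  (\<open>open_triplets_step\<close>, with triplets counted in both directions). The same cancellation between
  duplication and deletion shows that the expected sum of the degrees is exactly \<open>2 * n\<close> and that the
  expected sum of their squares is at most \<open>14 * n\<close>. So the expected number of open triplets grows by
  \<open>O(1 / n)\<close> in a step and stays below a multiple of the square root of \<open>n\<close>.

  To pass from expectations to almost sure statements, only the gain of each step is used: it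
  is nonnegative, its sum bounds the number of open triplets, and its expectation at
  step \<open>n\<close> is \<open>O(n powr (-1/2))\<close>. Hence the gains divided by \<open>n\<close> have a finite expected
  sum, so they are almost surely summable, and Kronecker's lemma gives the claim.

  Finally \<open>c 0 + c 1 < 1\<close>, because the degrees have total expectation \<open>2 * n\<close>, of which vertices of
  degree at most 1 contribute at most \<open>n + 1\<close>. As the sum of squares has expectation \<open>O(n)\<close>, the
  remainder cannot be concentrated on few vertices. Since proportions are bounded, their
  almost sure limits are also limits of expectations.
\<close>

section \<open>Degrees and open triplets\<close>

definition simple_graph :: "'v set \<Rightarrow> 'v set set \<Rightarrow> bool" where
  "simple_graph V E \<longleftrightarrow> finite V \<and> (\<forall>e\<in>E. e \<subseteq> V \<and> card e = 2)"

definition deg_sum :: "'v set \<Rightarrow> 'v set set \<Rightarrow> real" where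
  "deg_sum V E = (\<Sum>x\<in>V. real (degree E x))"

definition deg_square_sum :: "'v set \<Rightarrow> 'v set set \<Rightarrow> real" where
  "deg_square_sum V E = (\<Sum>x\<in>V. (real (degree E x))\<^sup>2)"

text \<open>
  Triplets are ordered, with the centre in the middle, so each path is counted in both directions.
  This turns the bookkeeping below into maps between sets of triples.
\<close>
definition open_triplets :: "'v set set \<Rightarrow> ('v \<times> 'v \<times> 'v) set" where
  "open_triplets E = {(y, x, z). y \<in> neighbours E x \<and> z \<in> neighbours E x \<and> y \<noteq> z \<and> {y, z} \<notin> E}"

definition open_triplets_at :: "'v set set \<Rightarrow> 'v \<Rightarrow> ('v \<times> 'v \<times> 'v) set" where
  "open_triplets_at E v = {(y, x, z) \<in> open_triplets E. v \<in> {y, x, z}}"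

lemma neighbours_sym: "y \<in> neighbours E x \<longleftrightarrow> x \<in> neighbours E y"
  by (auto simp: neighbours_def insert_commute)

lemma not_in_own_neighbours [simp]: "x \<notin> neighbours E x"
  by (simp add: neighbours_def)

lemma neighbours_subset: "simple_graph V E \<Longrightarrow> neighbours E x \<subseteq> V"
  by (auto simp: simple_graph_def neighbours_def)

lemma finite_neighbours: "simple_graph V E \<Longrightarrow> finite (neighbours E x)"
  by (rule finite_subset[OF neighbours_subset, of V]) (simp_all add: simple_graph_def)

lemma open_triplets_subset:
  assumes "simple_graph V E"
  shows "open_triplets E \<subseteq> V \<times> V \<times> V"
proof
  fix t assume t: "t \<in> open_triplets E"
  obtain y x z where [simp]: "t = (y, x, z)" by (cases t)
  have "y \<in> neighbours E x" "z \<in> neighbours E x" using t by (simp_all add: open_triplets_def)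
  moreover from this(1) have "x \<in> neighbours E y" by (simp add: neighbours_sym[of x E y])
  ultimately show "t \<in> V \<times> V \<times> V" using neighbours_subset[OF assms] by (simp add: subset_iff)
qed

lemma finite_open_triplets: "simple_graph V E \<Longrightarrow> finite (open_triplets E)"
  by (rule finite_subset[OF open_triplets_subset, of V]) (simp_all add: simple_graph_def)

lemma open_triplets_at_subset: "open_triplets_at E v \<subseteq> open_triplets E"
  by (auto simp: open_triplets_at_def)

lemma open_triplets_empty [simp]: "open_triplets {} = {}"
  by (auto simp: open_triplets_def neighbours_def)

text \<open>
  Double counting of adjacent pairs. It makes the duplication and deletion terms cancel
  when the second moments are averaged over the choices.
\<close>
lemma sum_neighbours_swap:
  fixes f :: "'v \<Rightarrow> real"
  assumes "simple_graph V E"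
  shows "(\<Sum>u\<in>V. \<Sum>x\<in>neighbours E u. f x) = (\<Sum>x\<in>V. real (degree E x) * f x)"
proof -
  have fin: "finite V" using assms by (simp add: simple_graph_def)
  have nb: "neighbours E u = {x \<in> V. x \<in> neighbours E u}" for u
    using neighbours_subset[OF assms] by auto
  have "(\<Sum>u\<in>V. \<Sum>x\<in>neighbours E u. f x) = (\<Sum>u\<in>V. \<Sum>x | x \<in> V \<and> x \<in> neighbours E u. f x)"
    by (subst nb) simp
  also have "\<dots> = (\<Sum>x\<in>V. \<Sum>u | u \<in> V \<and> x \<in> neighbours E u. f x)"
    by (rule sum.swap_restrict[OF fin fin])
  also have "\<dots> = (\<Sum>x\<in>V. real (degree E x) * f x)"
  proof (rule sum.cong[OF refl])
    fix x
    have "{u \<in> V. x \<in> neighbours E u} = neighbours E x"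
      using nb[of x] by (simp add: neighbours_sym[of x])
    then show "(\<Sum>u | u \<in> V \<and> x \<in> neighbours E u. f x) = real (degree E x) * f x"
      by (simp add: degree_def)
  qed
  finally show ?thesis .
qed

lemma sum_open_triplets_at:
  assumes "simple_graph V E"
  shows "(\<Sum>u\<in>V. real (card (open_triplets_at E u))) = 3 * real (card (open_triplets E))"
proof -
  have fin: "finite V" "finite (open_triplets E)"
    using assms finite_open_triplets by (auto simp: simple_graph_def)
  have "(\<Sum>u\<in>V. card (open_triplets_at E u)) = (\<Sum>u\<in>V. \<Sum>t | t \<in> open_triplets E \<and> (case t of (y, x, z) \<Rightarrow> u \<in> {y, x, z}). 1)"
    by (intro sum.cong refl) (simp add: open_triplets_at_def case_prod_unfold)
  also have "\<dots> = (\<Sum>t\<in>open_triplets E. \<Sum>u | u \<in> V \<and> (case t of (y, x, z) \<Rightarrow> u \<in> {y, x, z}). 1)"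
    by (rule sum.swap_restrict[OF fin])
  also have "\<dots> = (\<Sum>t\<in>open_triplets E. 3::nat)"
  proof (rule sum.cong[OF refl])
    fix t assume t: "t \<in> open_triplets E"
    obtain y x z where [simp]: "t = (y, x, z)" by (cases t)
    have "{y, x, z} \<subseteq> V" using t open_triplets_subset[OF assms] by auto
    then have "{u \<in> V. u \<in> {y, x, z}} = {y, x, z}" by blast
    moreover have "y \<noteq> x" "z \<noteq> x" "y \<noteq> z" using t by (auto simp: open_triplets_def)
    then have "card {y, x, z} = 3" by simp
    ultimately show "(\<Sum>u | u \<in> V \<and> (case t of (y, x, z) \<Rightarrow> u \<in> {y, x, z}). 1) = (3::nat)" by simp
  qed
  finally have "(\<Sum>u\<in>V. card (open_triplets_at E u)) = 3 * card (open_triplets E)" by simp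
  then show ?thesis by (metis of_nat_mult of_nat_numeral of_nat_sum)
qed

section \<open>The effect of one duplication-deletion step\<close>

locale duplication_deletion_step =
  fixes V :: "'v set" and E :: "'v set set" and w u v :: 'v
  assumes simple: "simple_graph V E" and new: "w \<notin> V" and u: "u \<in> V" and v: "v \<in> V"
begin

abbreviation E' :: "'v set set" where
  "E' \<equiv> delete_edges w v (duplicate w u E)"

lemma finite_vertices: "finite V" using simple by (simp add: simple_graph_def)

lemma edgeD: "{x, y} \<in> E \<Longrightarrow> x \<in> V \<and> y \<in> V \<and> x \<noteq> y"
proof -
  assume "{x, y} \<in> E"
  then have "{x, y} \<subseteq> V \<and> card {x, y} = 2" using simple unfolding simple_graph_def by blast
  then show ?thesis by (cases "x = y") simp_all
qed

lemma edge_new_old: "x \<in> V \<Longrightarrow> {w, x} \<in> E' \<longleftrightarrow> x \<in> insert u (neighbours E u)"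
  using edgeD[of w x] new u by (auto simp: delete_edges_def duplicate_def doubleton_eq_iff)

lemma edge_old_old: "x \<in> V \<Longrightarrow> y \<in> V \<Longrightarrow> {x, y} \<in> E' \<longleftrightarrow> {x, y} \<in> E \<and> x \<noteq> v \<and> y \<noteq> v"
  using new by (auto simp: delete_edges_def duplicate_def doubleton_eq_iff)

lemma simple_step: "simple_graph (insert w V) E'"
  unfolding simple_graph_def
proof (intro conjI ballI)
  show "finite (insert w V)" using finite_vertices by simp
  fix e assume "e \<in> E'"
  then have "e \<in> E \<or> (\<exists>x\<in>insert u (neighbours E u). e = {w, x})"
    unfolding delete_edges_def duplicate_def by blast
  then have "e \<subseteq> insert w V \<and> card e = 2"
  proof
    assume "e \<in> E"
    then show ?thesis using simple unfolding simple_graph_def by blast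
  next
    assume "\<exists>x\<in>insert u (neighbours E u). e = {w, x}"
    then obtain x where x: "x \<in> insert u (neighbours E u)" "e = {w, x}" by blast
    then have "x \<in> V" using neighbours_subset[OF simple, of u] u by blast
    moreover from this have "w \<noteq> x" using new by blast
    ultimately show ?thesis using x by simp
  qed
  then show "e \<subseteq> insert w V" "card e = 2" by simp_all
qed

lemma neighbours_new: "neighbours E' w = insert u (neighbours E u)"
proof -
  have "x \<in> neighbours E' w \<longleftrightarrow> x \<in> insert u (neighbours E u)" for x
  proof (cases "x \<in> V")
    case True
    then show ?thesis using edge_new_old[OF True] new unfolding neighbours_def[of E' w] by auto
  next
    case False
    then have "x \<notin> neighbours E' w"
      using neighbours_subset[OF simple_step, of w] by auto
    moreover have "x \<notin> insert u (neighbours E u)"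
      using False u neighbours_subset[OF simple, of u] by auto
    ultimately show ?thesis by simp
  qed
  then show ?thesis by blast
qed

lemma neighbours_old_iff:
  assumes "x \<in> V"
  shows "y \<in> neighbours E' x \<longleftrightarrow>
    (y = w \<and> x \<in> insert u (neighbours E u)) \<or> (x \<noteq> v \<and> y \<noteq> v \<and> y \<in> neighbours E x)"
  proof -
    consider "y = w" | "y \<in> V" | "y \<notin> insert w V" by blast
    then show ?thesis
    proof cases
      case 1
      have "w \<notin> neighbours E x" using neighbours_subset[OF simple] new by blast
      moreover have "w \<in> neighbours E' x \<longleftrightarrow> x \<in> insert u (neighbours E u)"
        unfolding neighbours_sym[of w E' x] neighbours_new ..
      ultimately show ?thesis using 1 by simp
    next
      case 2
      then have "y \<noteq> w" using new by blast
      then show ?thesis using edge_old_old[OF assms 2] by (simp add: neighbours_def conj_ac)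
    next
      case 3
      then have "y \<notin> neighbours E' x" "y \<notin> neighbours E x" "y \<noteq> w"
        using neighbours_subset[OF simple_step, of x] neighbours_subset[OF simple, of x] by blast+
      then show ?thesis by simp
    qed
  qed

lemma neighbours_old:
  assumes "x \<in> V"
  shows "neighbours E' x = (if x \<in> insert u (neighbours E u) then {w} else {}) \<union>
           (if x = v then {} else neighbours E x - {v})"
  by (rule set_eqI) (simp add: neighbours_old_iff[OF assms], argo)

text \<open>
  \<open>dup x\<close> indicates that the old vertex \<open>x\<close> gains the edge to the new vertex, \<open>del x\<close> that it
  loses its edge to \<open>v\<close>.
\<close>
abbreviation dup :: "'v \<Rightarrow> real" where "dup x \<equiv> of_bool (x \<in> insert u (neighbours E u))"
abbreviation del :: "'v \<Rightarrow> real" where "del x \<equiv> of_bool (x \<in> neighbours E v)"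

lemma degree_new: "degree E' w = degree E u + 1"
  using finite_neighbours[OF simple] by (simp add: degree_def neighbours_new)

text \<open>
  The vertex \<open>v\<close> fits the same formula as the other ones, because it is not its own neighbour:
  it keeps only the edge to the new vertex, if it has got one.
\<close>
lemma degree_old:
  assumes "x \<in> V"
  shows "real (degree E' x) = (if x = v then 0 else real (degree E x)) + dup x - del x"
proof (cases "x = v")
  case True
  then show ?thesis using assms by (simp add: degree_def neighbours_old)
next
  case False
  have *: "real (card (neighbours E x - {v})) = real (card (neighbours E x)) - del x"
  proof (cases "x \<in> neighbours E v")
    case True
    then have vx: "v \<in> neighbours E x" using neighbours_sym[of v E x] by blast
    have "card (neighbours E x) = Suc (card (neighbours E x - {v}))"
      by (rule card.remove[OF finite_neighbours[OF simple] vx])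
    then show ?thesis using True by simp
  next
    case F: False
    then have "v \<notin> neighbours E x" using neighbours_sym[of v E x] by blast
    then show ?thesis using F by simp
  qed
  have "w \<notin> neighbours E x - {v}" using neighbours_subset[OF simple, of x] new by blast
  moreover have "finite (neighbours E x - {v})" using finite_neighbours[OF simple] by simp
  ultimately have "real (degree E' x) = dup x + real (card (neighbours E x - {v}))"
    using False unfolding degree_def neighbours_old[OF assms] by simp
  then show ?thesis using False * by (simp add: degree_def)
qed

lemma sum_dup: "(\<Sum>x\<in>V. dup x * f x) = f u + (\<Sum>x\<in>neighbours E u. f x)"
proof -
  have *: "V \<inter> insert u (neighbours E u) = insert u (neighbours E u)"
    using neighbours_subset[OF simple, of u] u by auto
  have "(\<Sum>x\<in>V. dup x * f x) = (\<Sum>x\<in>V. if x \<in> insert u (neighbours E u) then f x else 0)"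
    by (intro sum.cong) auto
  also have "\<dots> = (\<Sum>x\<in>insert u (neighbours E u). f x)"
    using sum.inter_restrict[OF finite_vertices, of f "insert u (neighbours E u)"] unfolding * by (rule sym)
  finally show ?thesis using finite_neighbours[OF simple] by simp
qed

lemma sum_del: "(\<Sum>x\<in>V. del x * f x) = (\<Sum>x\<in>neighbours E v. f x)"
proof -
  have *: "V \<inter> neighbours E v = neighbours E v"
    using neighbours_subset[OF simple, of v] by auto
  have "(\<Sum>x\<in>V. del x * f x) = (\<Sum>x\<in>V. if x \<in> neighbours E v then f x else 0)"
    by (intro sum.cong) auto
  also have "\<dots> = (\<Sum>x\<in>neighbours E v. f x)"
    using sum.inter_restrict[OF finite_vertices, of f "neighbours E v"] * by simp
  finally show ?thesis .
qed

lemma deg_sum_step: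
  "deg_sum (insert w V) E' = deg_sum V E + 2 * (real (degree E u) + 1) - 2 * real (degree E v)"
proof -
  have "(\<Sum>x\<in>V. real (degree E' x))
      = (\<Sum>x\<in>V. real (degree E x) - (if x = v then real (degree E v) else 0) + dup x * 1 - del x * 1)"
    by (intro sum.cong refl) (simp add: degree_old)
  also have "\<dots> = deg_sum V E - real (degree E v) + (1 + real (degree E u)) - real (degree E v)"
    unfolding sum.distrib sum_subtractf sum_dup sum_del
    using v finite_vertices by (simp add: deg_sum_def degree_def)
  finally show ?thesis using finite_vertices new by (simp add: deg_sum_def degree_new)
qed

text \<open>
  For \<open>x \<noteq> v\<close> the degree \<open>d\<close> of \<open>x\<close> becomes \<open>d + i - j\<close> with \<open>i, j \<in> {0, 1}\<close>, and
  \<open>(d + i - j)\<^sup>2 \<le> d\<^sup>2 + i * (2 * d + 1) - j * (2 * d - 1)\<close>: only the cross term of \<open>i\<close> and \<open>j\<close>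
  is dropped, and it is not positive.
\<close>
lemma deg_square_sum_step:
  "deg_square_sum (insert w V) E' \<le> deg_square_sum V E + (real (degree E u) + 1)\<^sup>2
     + (2 * real (degree E u) + 1 + (\<Sum>x\<in>neighbours E u. 2 * real (degree E x) + 1))
     - (\<Sum>x\<in>neighbours E v. 2 * real (degree E x) - 1) - (real (degree E v))\<^sup>2"
proof -
  have "(\<Sum>x\<in>V. (real (degree E' x))\<^sup>2)
      \<le> (\<Sum>x\<in>V. (real (degree E x))\<^sup>2 - (if x = v then (real (degree E v))\<^sup>2 else 0)
          + dup x * (2 * real (degree E x) + 1) - del x * (2 * real (degree E x) - 1))"
    by (intro sum_mono) (auto simp: degree_old of_bool_def power2_eq_square algebra_simps)
  also have "\<dots> = deg_square_sum V E - (real (degree E v))\<^sup>2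
      + (2 * real (degree E u) + 1 + (\<Sum>x\<in>neighbours E u. 2 * real (degree E x) + 1))
      - (\<Sum>x\<in>neighbours E v. 2 * real (degree E x) - 1)"
    unfolding sum.distrib[where A=V] sum_subtractf[where A=V] sum_dup sum_del
    using v finite_vertices by (simp add: deg_square_sum_def)
  finally show ?thesis using finite_vertices new by (simp add: deg_square_sum_def degree_new add.commute)
qed

text \<open>
  The copy of an open triplet through \<open>u\<close> replaces \<open>u\<close> by the new vertex \<open>w\<close>. No other open triplet
  can contain \<open>w\<close> while all edges are still present, because \<open>u\<close> and \<open>w\<close> are adjacent and have the
  same other neighbours. Deleting the edges of \<open>v\<close> cannot open a closed triplet unless \<open>v\<close> stays
  connected, and then \<open>w\<close> is its only neighbour: the triplets concerned are those with
  centre \<open>w\<close> and one end \<open>v\<close>.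
\<close>
lemma open_triplets_step:
  "real (card (open_triplets E')) \<le> real (card (open_triplets E))
     + real (card (open_triplets_at E u)) - real (card (open_triplets_at E v))
     + 2 * (real (degree E u) * of_bool (v \<in> insert u (neighbours E u)))"
proof -
  \<comment> \<open>\<open>C\<close>, \<open>L\<close> and \<open>R\<close> collect the open triplets in which \<open>u\<close> is the centre, the first and the
    last vertex; their copies have \<open>w\<close> in that position. \<open>P\<close> collects the triplets opened by the
    kept edge between \<open>v\<close> and \<open>w\<close>.\<close>
  define N where "N = insert u (neighbours E u)"
  define C where "C = {(y, x, z) \<in> open_triplets E. x = u}"
  define L where "L = {(y, x, z) \<in> open_triplets E. y = u}"
  define R where "R = {(y, x, z) \<in> open_triplets E. z = u}"
  define P where "P = (if v \<in> N then (\<lambda>z. (v, w, z)) ` (N - {v}) \<union> (\<lambda>y. (y, w, v)) ` (N - {v}) else {})"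
  have finO: "finite (open_triplets E)" using simple by (rule finite_open_triplets)
  have finite_vertices': "finite C" "finite L" "finite R"
    unfolding C_def L_def R_def using finO by (auto intro: rev_finite_subset[OF finO])
  have finN: "finite N" using finite_neighbours[OF simple] by (simp add: N_def)
  have old_E: "{x, y} \<in> E \<longleftrightarrow> y \<in> neighbours E x" for x y
    using edgeD[of x y] by (auto simp: neighbours_def)
  have sub: "open_triplets E' \<subseteq> (open_triplets E - open_triplets_at E v) \<union>
      ((\<lambda>(y, x, z). (y, w, z)) ` C \<union> (\<lambda>(y, x, z). (w, x, z)) ` L \<union> (\<lambda>(y, x, z). (y, x, w)) ` R) \<union> P"
    (is "_ \<subseteq> ?A \<union> (?C \<union> ?L \<union> ?R) \<union> P")
  proof
    fix t assume "t \<in> open_triplets E'"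
    moreover obtain y x z where [simp]: "t = (y, x, z)" by (cases t)
    ultimately have y: "y \<in> neighbours E' x" and z: "z \<in> neighbours E' x"
      and yz: "y \<noteq> z" "{y, z} \<notin> E'"
      by (simp_all add: open_triplets_def)
    have NV: "N \<subseteq> V" using neighbours_subset[OF simple, of u] u by (simp add: N_def)
    have nbV: "neighbours E a \<subseteq> V" for a by (rule neighbours_subset[OF simple])
    have nbV': "neighbours E' a \<subseteq> insert w V" for a by (rule neighbours_subset[OF simple_step])
    show "t \<in> ?A \<union> (?C \<union> ?L \<union> ?R) \<union> P"
    proof (cases "x = w")
      case xw: True
      then have yN: "y \<in> N" and zN: "z \<in> N" using y z by (simp_all add: neighbours_new N_def)
      show ?thesis
      proof (cases "v = y \<or> v = z")
        case True
        then have "t \<in> P" using yN zN yz xw by (auto simp: P_def)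
        then show ?thesis by blast
      next
        case False
        then have ne: "{y, z} \<notin> E" using yz(2) edge_old_old[of y z] yN zN NV by blast
        have "y \<noteq> u"
          using ne zN yz(1) old_E[of u z] by (auto simp: N_def)
        moreover have "z \<noteq> u"
          using ne yN yz(1) old_E[of u y] by (auto simp: N_def insert_commute)
        ultimately have "(y, u, z) \<in> C"
          using yN zN yz(1) ne by (simp add: N_def C_def open_triplets_def)
        then have "t \<in> ?C" using xw by (auto intro!: rev_image_eqI)
        then show ?thesis by blast
      qed
    next
      case False
      then have xV: "x \<in> V" using y nbV'[of y] neighbours_sym[of y E' x] by blast
      consider "y = w" | "z = w" | "y \<noteq> w" "z \<noteq> w" by blast
      then show ?thesis
      proof cases
        case 1
        then have xN: "x \<in> N" and zx: "z \<in> neighbours E x"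
          using y z yz(1) nbV[of x] new neighbours_old_iff[OF xV] by (auto simp: N_def)
        have zN: "z \<notin> N" using yz(2) 1 edge_new_old[of z] zx nbV[of x] by (auto simp: N_def)
        have "x \<noteq> u" using zx zN by (auto simp: N_def)
        then have "u \<in> neighbours E x" using xN neighbours_sym[of u E x] by (simp add: N_def)
        moreover have "u \<noteq> z" "{u, z} \<notin> E" using zN old_E[of u z] by (auto simp: N_def)
        ultimately have "(u, x, z) \<in> L" using zx by (simp add: L_def open_triplets_def)
        then have "t \<in> ?L" using 1 by (auto intro!: rev_image_eqI)
        then show ?thesis by blast
      next
        case 2
        then have xN: "x \<in> N" and yx: "y \<in> neighbours E x"
          using y z yz(1) nbV[of x] new neighbours_old_iff[OF xV] by (auto simp: N_def)
        have yN: "y \<notin> N"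
          using yz(2) 2 edge_new_old[of y] yx nbV[of x] insert_commute[of y w "{}"] by (auto simp: N_def)
        have "x \<noteq> u" using yx yN by (auto simp: N_def)
        then have "u \<in> neighbours E x" using xN neighbours_sym[of u E x] by (simp add: N_def)
        moreover have "y \<noteq> u" "{y, u} \<notin> E"
          using yN old_E[of u y] insert_commute[of y u "{}"] by (auto simp: N_def)
        ultimately have "(y, x, u) \<in> R" using yx by (simp add: R_def open_triplets_def)
        then have "t \<in> ?R" using 2 by (auto intro!: rev_image_eqI)
        then show ?thesis by blast
      next
        case 3
        then have nv: "x \<noteq> v" "y \<noteq> v" "z \<noteq> v" and nb: "y \<in> neighbours E x" "z \<in> neighbours E x"
          using y z neighbours_old_iff[OF xV] by auto
        then have "{y, z} \<notin> E" using yz(2) edge_old_old[of y z] nbV[of x] by blast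
        then have "t \<in> ?A" using nv nb yz(1) by (simp add: open_triplets_def open_triplets_at_def)
        then show ?thesis by blast
      qed
    qed
  qed
  have "card (open_triplets E') \<le> card (?A \<union> (?C \<union> ?L \<union> ?R) \<union> P)"
    by (rule card_mono[OF _ sub]) (use finO finite_vertices' finN in \<open>auto simp: P_def\<close>)
  also have "\<dots> \<le> card ?A + (card C + card L + card R) + card P"
    by (intro order.trans[OF card_Un_le] add_mono card_image_le finite_vertices' order.refl)
  also have "card C + card L + card R = card (open_triplets_at E u)"
  proof -
    have "open_triplets_at E u = C \<union> L \<union> R"
      by (auto simp: open_triplets_at_def C_def L_def R_def)
    moreover have "C \<inter> L = {}" "(C \<union> L) \<inter> R = {}"
      by (auto simp: C_def L_def R_def open_triplets_def)
    ultimately show ?thesis using finite_vertices' by (simp add: card_Un_disjoint)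
  qed
  also have "card P \<le> 2 * (degree E u * of_bool (v \<in> N))"
  proof (cases "v \<in> N")
    case True
    have "card N = degree E u + 1" using finite_neighbours[OF simple] by (simp add: N_def degree_def)
    then have c: "card (N - {v}) = degree E u" using True finN by simp
    have "card P \<le> card ((\<lambda>z. (v, w, z)) ` (N - {v})) + card ((\<lambda>y. (y, w, v)) ` (N - {v}))"
      unfolding P_def using True card_Un_le by simp
    also have "\<dots> \<le> card (N - {v}) + card (N - {v})"
      by (intro add_mono card_image_le) (use finN in auto)
    finally show ?thesis using True c by simp
  qed (simp add: P_def)
  finally have "card (open_triplets E') \<le> card ?A + card (open_triplets_at E u) + 2 * (degree E u * of_bool (v \<in> N))"
    by simp
  then have "real (card (open_triplets E')) \<le> real (card ?A) + real (card (open_triplets_at E u)) + 2 * (real (degree E u) * of_bool (v \<in> N))"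
    by (metis (mono_tags, lifting) of_nat_add of_nat_le_iff of_nat_mult of_nat_numeral of_nat_of_bool)
  moreover have "real (card ?A) = real (card (open_triplets E)) - real (card (open_triplets_at E v))"
    using open_triplets_at_subset[of E v] finO
    by (simp add: card_Diff_subset finite_subset[of _ "open_triplets E"] card_mono of_nat_diff)
  ultimately show ?thesis by (simp add: N_def)
qed

end

section \<open>Averages of the step over both choices\<close>

text \<open>
  The losses are left out on purpose: the gain has to be nonnegative for the almost sure argument,
  whereas the cancellation against the losses matters only for expectations.
\<close>
definition open_triplet_gain :: "'v set set \<Rightarrow> 'v \<Rightarrow> 'v \<Rightarrow> real" where
  "open_triplet_gain E u v = real (card (open_triplets_at E u))
     + 2 * (real (degree E u) * of_bool (v \<in> insert u (neighbours E u)))"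

definition deg_square_change :: "'v set set \<Rightarrow> 'v \<Rightarrow> 'v \<Rightarrow> real" where
  "deg_square_change E u v = ((real (degree E u) + 1)\<^sup>2
       + (2 * real (degree E u) + 1 + (\<Sum>x\<in>neighbours E u. 2 * real (degree E x) + 1)))
     - ((\<Sum>x\<in>neighbours E v. 2 * real (degree E x) - 1) + (real (degree E v))\<^sup>2)"

lemma sum_pairs_diff:
  fixes f g :: "'v \<Rightarrow> real"
  shows "(\<Sum>u\<in>V. \<Sum>v\<in>V. f u - g v) = real (card V) * ((\<Sum>u\<in>V. f u) - (\<Sum>v\<in>V. g v))"
  by (simp add: sum_subtractf right_diff_distrib flip: sum_distrib_left)

text \<open>
  The sum of squares itself has cancelled: only the sum of the degrees, which is linear in
  expectation, drives the growth of the second moment.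
\<close>
lemma sum_deg_square_change:
  assumes "simple_graph V E"
  shows "(\<Sum>u\<in>V. \<Sum>v\<in>V. deg_square_change E u v) = real (card V) * (6 * deg_sum V E + 2 * real (card V))"
proof -
  have "(\<Sum>u\<in>V. (real (degree E u) + 1)\<^sup>2
       + (2 * real (degree E u) + 1 + (\<Sum>x\<in>neighbours E u. 2 * real (degree E x) + 1)))
     = 3 * deg_square_sum V E + 5 * deg_sum V E + 2 * real (card V)"
    unfolding sum.distrib[where A=V] sum_neighbours_swap[OF assms]
    by (simp add: power2_sum sum.distrib deg_square_sum_def deg_sum_def power2_eq_square algebra_simps
        flip: sum_distrib_left)
  moreover have "(\<Sum>v\<in>V. (\<Sum>x\<in>neighbours E v. 2 * real (degree E x) - 1) + (real (degree E v))\<^sup>2)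
     = 3 * deg_square_sum V E - deg_sum V E"
    unfolding sum.distrib[where A=V] sum_neighbours_swap[OF assms]
    by (simp add: sum_subtractf deg_square_sum_def deg_sum_def power2_eq_square algebra_simps
        flip: sum_distrib_left)
  ultimately show ?thesis
    unfolding deg_square_change_def sum_pairs_diff by simp
qed

lemma sum_open_triplet_gain:
  assumes "simple_graph V E"
  shows "(\<Sum>u\<in>V. \<Sum>v\<in>V. open_triplet_gain E u v)
    = 3 * real (card V) * real (card (open_triplets E)) + 2 * (deg_square_sum V E + deg_sum V E)"
proof -
  have fin: "finite V" using assms by (simp add: simple_graph_def)
  have "(\<Sum>v\<in>V. open_triplet_gain E u v)
      = real (card V) * real (card (open_triplets_at E u)) + 2 * ((real (degree E u))\<^sup>2 + real (degree E u))"
    if "u \<in> V" for u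
  proof -
    have sub: "insert u (neighbours E u) \<subseteq> V" using neighbours_subset[OF assms] that by blast
    have "(\<Sum>v\<in>V. of_bool (v \<in> insert u (neighbours E u)) :: real) = real (card (V \<inter> insert u (neighbours E u)))"
      by (simp add: of_bool_def sum.If_cases[OF fin] Int_def)
    also have "V \<inter> insert u (neighbours E u) = insert u (neighbours E u)" using sub by blast
    also have "real (card (insert u (neighbours E u))) = real (degree E u) + 1"
      using finite_neighbours[OF assms] by (simp add: degree_def)
    finally have *: "(\<Sum>v\<in>V. of_bool (v \<in> insert u (neighbours E u)) :: real) = real (degree E u) + 1" .
    have "(\<Sum>v\<in>V. open_triplet_gain E u v) = real (card V) * real (card (open_triplets_at E u))
        + 2 * (real (degree E u) * (\<Sum>v\<in>V. of_bool (v \<in> insert u (neighbours E u))))"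
      unfolding open_triplet_gain_def sum.distrib sum_distrib_left by simp
    then show ?thesis unfolding * by (simp add: power2_eq_square algebra_simps)
  qed
  then have "(\<Sum>u\<in>V. \<Sum>v\<in>V. open_triplet_gain E u v) = (\<Sum>u\<in>V.
      real (card V) * real (card (open_triplets_at E u)) + 2 * ((real (degree E u))\<^sup>2 + real (degree E u)))"
    by (intro sum.cong refl)
  also have "\<dots> = real (card V) * (3 * real (card (open_triplets E))) + 2 * (deg_square_sum V E + deg_sum V E)"
    unfolding sum.distrib sum_distrib_left[symmetric] sum_open_triplets_at[OF assms]
      deg_square_sum_def deg_sum_def ..
  finally show ?thesis by simp
qed

section \<open>Clustering coefficients and open triplets\<close>

definition closed_pairs :: "'v set set \<Rightarrow> 'v \<Rightarrow> 'v set set" where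
  "closed_pairs E x = {P. P \<subseteq> neighbours E x \<and> card P = 2 \<and> P \<in> E}"

definition open_pairs :: "'v set set \<Rightarrow> 'v \<Rightarrow> 'v set set" where
  "open_pairs E x = {P. P \<subseteq> neighbours E x \<and> card P = 2 \<and> P \<notin> E}"

definition large_degree :: "'v set \<Rightarrow> 'v set set \<Rightarrow> 'v set" where
  "large_degree V E = {x \<in> V. degree E x \<ge> 2}"

lemma
  assumes "simple_graph V E"
  shows finite_closed_pairs: "finite (closed_pairs E x)"
    and finite_open_pairs: "finite (open_pairs E x)"
    and card_closed_open_pairs: "card (closed_pairs E x) + card (open_pairs E x) = degree E x choose 2"
proof -
  have fin: "finite (neighbours E x)" using assms by (rule finite_neighbours)
  have eq: "closed_pairs E x \<union> open_pairs E x = {P. P \<subseteq> neighbours E x \<and> card P = 2}"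
    by (auto simp: closed_pairs_def open_pairs_def)
  have "finite (closed_pairs E x \<union> open_pairs E x)"
    unfolding eq using fin by simp
  then show f: "finite (closed_pairs E x)" "finite (open_pairs E x)" by simp_all
  have "closed_pairs E x \<inter> open_pairs E x = {}"
    by (auto simp: closed_pairs_def open_pairs_def)
  then have "card (closed_pairs E x) + card (open_pairs E x) = card (closed_pairs E x \<union> open_pairs E x)"
    using f by (simp add: card_Un_disjoint)
  then show "card (closed_pairs E x) + card (open_pairs E x) = degree E x choose 2"
    unfolding eq using n_subsets[OF fin] by (simp add: degree_def)
qed

lemma sum_open_pairs_le:
  assumes "simple_graph V E"
  shows "(\<Sum>x\<in>V. card (open_pairs E x)) \<le> card (open_triplets E)"
proof -
  have fin: "finite V" using assms by (simp add: simple_graph_def)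
  have "(\<Sum>x\<in>V. card (open_pairs E x)) = card (SIGMA x:V. open_pairs E x)"
    using fin finite_open_pairs[OF assms] by simp
  also have "\<dots> \<le> card ((\<lambda>(y, x, z). (x, {y, z})) ` open_triplets E)"
  proof (rule card_mono)
    show "(SIGMA x:V. open_pairs E x) \<subseteq> (\<lambda>(y, x, z). (x, {y, z})) ` open_triplets E"
    proof
      fix p assume "p \<in> (SIGMA x:V. open_pairs E x)"
      then obtain x P where p: "p = (x, P)" "P \<in> open_pairs E x" by blast
      then have "card P = 2" by (simp add: open_pairs_def)
      then obtain y z where P: "P = {y, z}" "y \<noteq> z" by (auto simp: card_2_iff)
      with p(2) have "(y, x, z) \<in> open_triplets E"
        by (simp add: open_pairs_def open_triplets_def)
      from imageI[OF this, of "\<lambda>(y, x, z). (x, {y, z})"]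
      show "p \<in> (\<lambda>(y, x, z). (x, {y, z})) ` open_triplets E"
        using p(1) P(1) by simp
    qed
  qed (simp add: finite_open_triplets[OF assms])
  also have "\<dots> \<le> card (open_triplets E)"
    by (rule card_image_le[OF finite_open_triplets[OF assms]])
  finally show ?thesis .
qed

text \<open>A vertex with a closed pair of its neighbours is a triangle with a distinguished corner.\<close>
lemma sum_closed_pairs:
  assumes "simple_graph V E"
  shows "(\<Sum>x\<in>V. card (closed_pairs E x)) = 3 * card (triangles V E)"
proof -
  have fin: "finite V" using assms by (simp add: simple_graph_def)
  have edge_nb: "y \<in> neighbours E x \<longleftrightarrow> x \<noteq> y \<and> {x, y} \<in> E" for x y
    by (auto simp: neighbours_def)
  have "bij_betw (\<lambda>(T, x). (x, T - {x})) (SIGMA T:triangles V E. T) (SIGMA x:V. closed_pairs E x)"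
  proof (rule bij_betw_byWitness[where f' = "\<lambda>(x, P). (insert x P, x)"])
    show "\<forall>a\<in>SIGMA T:triangles V E. T. (\<lambda>(x, P). (insert x P, x)) ((\<lambda>(T, x). (x, T - {x})) a) = a"
      by (auto simp: insert_absorb)
    show "\<forall>a'\<in>SIGMA x:V. closed_pairs E x. (\<lambda>(T, x). (x, T - {x})) ((\<lambda>(x, P). (insert x P, x)) a') = a'"
      by (auto simp: closed_pairs_def)
    show "(\<lambda>(T, x). (x, T - {x})) ` (SIGMA T:triangles V E. T) \<subseteq> (SIGMA x:V. closed_pairs E x)"
    proof clarify
      fix T x assume T: "T \<in> triangles V E" "x \<in> T"
      then have TV: "T \<subseteq> V" "card T = 3" and adj: "\<And>a b. a \<in> T \<Longrightarrow> b \<in> T \<Longrightarrow> a \<noteq> b \<Longrightarrow> {a, b} \<in> E"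
        by (auto simp: triangles_def)
      have c: "card (T - {x}) = 2" using TV T(2) by simp
      then obtain y z where yz: "T - {x} = {y, z}" "y \<noteq> z" by (auto simp: card_2_iff)
      then have m: "y \<in> T" "z \<in> T" "x \<noteq> y" "x \<noteq> z" by blast+
      have "{y, z} \<in> E" "{x, y} \<in> E" "{x, z} \<in> E"
        using adj[OF m(1,2) yz(2)] adj[OF T(2) m(1) m(3)] adj[OF T(2) m(2) m(4)] .
      then have "T - {x} \<in> closed_pairs E x"
        using c m(3,4) unfolding closed_pairs_def yz(1) by (simp add: edge_nb)
      then show "x \<in> V \<and> T - {x} \<in> closed_pairs E x"
        using TV(1) T(2) by blast
    qed
    show "(\<lambda>(x, P). (insert x P, x)) ` (SIGMA x:V. closed_pairs E x) \<subseteq> (SIGMA T:triangles V E. T)"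
    proof clarify
      fix x P assume x: "x \<in> V" and "P \<in> closed_pairs E x"
      then have P: "P \<subseteq> neighbours E x" "card P = 2" "P \<in> E" by (auto simp: closed_pairs_def)
      then obtain y z where yz: "P = {y, z}" "y \<noteq> z" by (auto simp: card_2_iff)
      have PV: "P \<subseteq> V" using P(1) neighbours_subset[OF assms] by blast
      have xP: "x \<notin> P" using P(1) by auto
      have "finite P" using PV fin by (rule finite_subset)
      then have "card (insert x P) = 3" using xP P(2) by simp
      moreover have "\<forall>a\<in>insert x P. \<forall>b\<in>insert x P. a \<noteq> b \<longrightarrow> {a, b} \<in> E"
      proof (intro ballI impI)
        fix a b assume ab: "a \<in> insert x P" "b \<in> insert x P" "a \<noteq> b"
        have xE: "{x, c} \<in> E" if "c \<in> P" for c using P(1) that edge_nb by blast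
        consider "a = x" "b \<in> P" | "b = x" "a \<in> P" | "a \<in> P" "b \<in> P" using ab by blast
        then show "{a, b} \<in> E"
        proof cases
          case 2
          then show ?thesis using xE[of a] by (simp add: insert_commute[of a x])
        next
          case 3
          then have "{a, b} = P" using ab(3) yz(1) by blast
          then show ?thesis using P(3) by simp
        qed (use xE in simp)
      qed
      moreover have "insert x P \<subseteq> V" using x PV by blast
      ultimately have "insert x P \<in> triangles V E"
        unfolding triangles_def by (intro CollectI conjI)
      then show "insert x P \<in> triangles V E \<and> x \<in> insert x P" by blast
    qed
  qed
  then have "card (SIGMA T:triangles V E. T) = card (SIGMA x:V. closed_pairs E x)"
    by (rule bij_betw_same_card)
  moreover have "card (SIGMA x:V. closed_pairs E x) = (\<Sum>x\<in>V. card (closed_pairs E x))"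
    using fin finite_closed_pairs[OF assms] by simp
  moreover have "card (SIGMA T:triangles V E. T) = 3 * card (triangles V E)"
  proof -
    have T: "T \<subseteq> V \<and> card T = 3" if "T \<in> triangles V E" for T
      using that by (simp add: triangles_def)
    have "triangles V E \<subseteq> Pow V" using T by auto
    then have "finite (triangles V E)" using fin by (simp add: finite_subset)
    moreover have "\<forall>T\<in>triangles V E. finite T" using T fin finite_subset by blast
    ultimately have "card (SIGMA T:triangles V E. T) = (\<Sum>T\<in>triangles V E. card T)" by simp
    also have "\<dots> = (\<Sum>T\<in>triangles V E. 3)" using T by (intro sum.cong) auto
    finally show ?thesis by simp
  qed
  ultimately show ?thesis by simp
qed

lemma card_connected_triplets:
  assumes "simple_graph V E"
  shows "card (connected_triplets V E) = (\<Sum>x\<in>V. degree E x choose 2)"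
proof -
  have "connected_triplets V E = (SIGMA x:V. {P. P \<subseteq> neighbours E x \<and> card P = 2})"
    by (auto simp: connected_triplets_def)
  moreover have "finite V" using assms by (simp add: simple_graph_def)
  ultimately show ?thesis
    using finite_neighbours[OF assms] by (simp add: n_subsets degree_def)
qed

text \<open>
  A connected triplet is closed or open, every triangle accounts for three closed ones, and each
  vertex of degree at least 2 is the centre of some triplet, so there are at least
  \<open>card (large_degree V E)\<close> triplets in total.
\<close>
lemma global_clustering_bounds:
  assumes "simple_graph V E" and "large_degree V E \<noteq> {}"
  shows "\<bar>global_clustering V E - 1\<bar> \<le> real (card (open_triplets E)) / real (card (large_degree V E))"
proof -
  have fin: "finite V" using assms by (simp add: simple_graph_def)
  define p where "p = card (connected_triplets V E)"
  define b where "b = (\<Sum>x\<in>V. card (open_pairs E x))"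
  have p: "p = (\<Sum>x\<in>V. degree E x choose 2)"
    unfolding p_def by (rule card_connected_triplets[OF assms(1)])
  have pb: "p = 3 * card (triangles V E) + b"
    unfolding p b_def card_closed_open_pairs[OF assms(1), symmetric] sum.distrib
      sum_closed_pairs[OF assms(1)] ..
  have "card (large_degree V E) = (\<Sum>x\<in>large_degree V E. 1)" by simp
  also have "\<dots> \<le> (\<Sum>x\<in>large_degree V E. degree E x choose 2)"
    by (intro sum_mono) (simp add: large_degree_def Suc_leI)
  also have "\<dots> \<le> p"
    unfolding p by (rule sum_mono2[OF fin]) (auto simp: large_degree_def)
  finally have le: "card (large_degree V E) \<le> p" .
  have pos: "card (large_degree V E) > 0"
    using assms(2) fin by (simp add: card_gt_0_iff large_degree_def)
  have "global_clustering V E = (real p - real b) / real p"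
    using pb by (simp add: global_clustering_def p_def)
  then have "\<bar>global_clustering V E - 1\<bar> = real b / real p"
    using le pos by (simp add: diff_divide_distrib)
  also have "\<dots> \<le> real (card (open_triplets E)) / real (card (large_degree V E))"
    using le pos sum_open_pairs_le[OF assms(1)] unfolding b_def[symmetric]
    by (intro frac_le) simp_all
  finally show ?thesis .
qed

lemma local_clustering_bounds:
  assumes "simple_graph V E"
  shows "\<bar>local_clustering E x - of_bool (degree E x \<ge> 2)\<bar> \<le> real (card (open_pairs E x))"
proof (cases "degree E x \<ge> 2")
  case True
  define d where "d = degree E x choose 2"
  have d: "d > 0" using True by (simp add: d_def)
  have c: "card (closed_pairs E x) + card (open_pairs E x) = d"
    unfolding d_def by (rule card_closed_open_pairs[OF assms])
  have "local_clustering E x = real (card (closed_pairs E x)) / real d"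
    using True by (simp add: local_clustering_def closed_pairs_def d_def)
  also have "\<dots> = 1 - real (card (open_pairs E x)) / real d"
  proof -
    have "real (card (closed_pairs E x)) = real d - real (card (open_pairs E x))" using c by linarith
    then show ?thesis using d by (simp add: diff_divide_distrib)
  qed
  finally have "\<bar>local_clustering E x - of_bool (degree E x \<ge> 2)\<bar> = real (card (open_pairs E x)) / real d"
    using True by simp
  also have "\<dots> \<le> real (card (open_pairs E x))"
    using divide_left_mono[of 1 "real d" "real (card (open_pairs E x))"] d by simp
  finally show ?thesis .
qed (simp add: local_clustering_def)

text \<open>
  Each vertex whose local coefficient differs from the indicator of degree at least 2 is
  the centre of an open triplet.
\<close>
lemma average_clustering_bounds:
  assumes "simple_graph V E"
  shows "\<bar>average_clustering V E - real (card (large_degree V E)) / real (card V)\<bar>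
    \<le> real (card (open_triplets E)) / real (card V)"
proof -
  have fin: "finite V" using assms by (simp add: simple_graph_def)
  have l: "real (card (large_degree V E)) = (\<Sum>x\<in>V. of_bool (degree E x \<ge> 2))"
    using fin by (simp add: large_degree_def sum.If_cases of_bool_def Int_def)
  have "average_clustering V E - real (card (large_degree V E)) / real (card V)
      = (\<Sum>x\<in>V. local_clustering E x - of_bool (degree E x \<ge> 2)) / real (card V)"
    by (simp add: average_clustering_def l sum_subtractf diff_divide_distrib)
  moreover have "\<bar>\<Sum>x\<in>V. local_clustering E x - of_bool (degree E x \<ge> 2)\<bar> \<le> real (card (open_triplets E))"
  proof -
    have "\<bar>\<Sum>x\<in>V. local_clustering E x - of_bool (degree E x \<ge> 2)\<bar>
        \<le> (\<Sum>x\<in>V. real (card (open_pairs E x)))"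
      by (rule order.trans[OF sum_abs]) (intro sum_mono local_clustering_bounds[OF assms])
    also have "\<dots> \<le> real (card (open_triplets E))"
      using sum_open_pairs_le[OF assms] by (simp flip: of_nat_sum)
    finally show ?thesis .
  qed
  ultimately show ?thesis by (simp add: divide_right_mono)
qed

text \<open>
  A second moment argument in linear form: a degree \<open>d\<close> is at most 1, or at least 2 and then at
  most \<open>k\<close> or at most \<open>d\<^sup>2 / k\<close>. Being linear in all three quantities, the bound survives expectations.
\<close>
lemma deg_sum_le_large_degree:
  assumes "finite V" "k > 0"
  shows "deg_sum V E \<le> real (card V) + k * real (card (large_degree V E)) + deg_square_sum V E / k"
proof -
  have *: "real d \<le> 1 + k * of_bool (d \<ge> 2) + (real d)\<^sup>2 / k" for d :: nat
  proof (cases "d \<ge> 2")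
    case True
    have "0 \<le> k * real d" using assms(2) by simp
    then have "k * real d \<le> k * k + (real d)\<^sup>2"
      using sum_squares_bound[of k "real d"] unfolding power2_eq_square[of k] by linarith
    then have "real d \<le> (k * k + (real d)\<^sup>2) / k"
      using assms(2) by (simp add: pos_le_divide_eq mult.commute)
    then have "real d \<le> k + (real d)\<^sup>2 / k"
      using assms(2) by (simp add: add_divide_distrib)
    then show ?thesis using True by simp
  next
    case False
    then have "real d \<le> 1" by simp
    moreover have "0 \<le> (real d)\<^sup>2 / k" using assms(2) by simp
    ultimately show ?thesis using False by simp
  qed
  have l: "real (card (large_degree V E)) = (\<Sum>x\<in>V. of_bool (degree E x \<ge> 2))"
    using assms by (simp add: large_degree_def sum.If_cases of_bool_def Int_def)
  have "deg_sum V E \<le> (\<Sum>x\<in>V. 1 + k * of_bool (degree E x \<ge> 2) + (real (degree E x))\<^sup>2 / k)"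
    unfolding deg_sum_def by (intro sum_mono *)
  also have "\<dots> = real (card V) + k * real (card (large_degree V E)) + deg_square_sum V E / k"
    by (simp add: l sum.distrib sum_distrib_left sum_divide_distrib deg_square_sum_def)
  finally show ?thesis .
qed

section \<open>Analytic tools\<close>

text \<open>
  Kronecker's lemma for nonnegative terms. Dividing the partial sums by \<open>n + 1\<close> makes every single
  term vanish in the limit, and \<open>a k / (k + 1)\<close> is a summable majorant, so Tannery's theorem applies.
\<close>
lemma kronecker_nonneg:
  fixes a :: "nat \<Rightarrow> real"
  assumes nonneg: "\<And>k. a k \<ge> 0" and sum: "summable (\<lambda>k. a k / (real k + 1))"
  shows "(\<lambda>n. (\<Sum>k<n. a k) / (real n + 1)) \<longlonglongrightarrow> 0"
proof -
  define f where "f = (\<lambda>k n. if k < n then a k / (real n + 1) else 0)"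
  have lim: "(\<lambda>n. f k n) \<longlonglongrightarrow> 0" for k
  proof (rule Lim_transform_eventually)
    show "(\<lambda>n. a k / (real n + 1)) \<longlonglongrightarrow> 0" by real_asymp
    show "\<forall>\<^sub>F n in sequentially. a k / (real n + 1) = f k n"
      using eventually_gt_at_top[of k] by eventually_elim (simp add: f_def)
  qed
  have "norm (f k n) \<le> a k / (real k + 1)" for k n
    using nonneg[of k] by (auto simp: f_def intro!: divide_left_mono)
  then have "\<forall>\<^sub>F (k, n) in at_top \<times>\<^sub>F sequentially. norm (f k n) \<le> a k / (real k + 1)"
    by (simp add: always_eventually)
  from tannerys_theorem[OF lim this sum]
  have "(\<lambda>n. suminf (\<lambda>k. f k n)) \<longlonglongrightarrow> 0" by simp
  moreover have "suminf (\<lambda>k. f k n) = (\<Sum>k<n. a k) / (real n + 1)" for n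
  proof -
    have "suminf (\<lambda>k. f k n) = (\<Sum>k\<in>{..<n}. f k n)"
      by (rule suminf_finite) (auto simp: f_def)
    then show ?thesis by (simp add: f_def sum_divide_distrib)
  qed
  ultimately show ?thesis by simp
qed

lemma inverse_le_sqrt_diff: "1 / (real n + 1) \<le> 2 * (sqrt (real n + 1) - sqrt (real n))"
proof -
  define a b where "a = sqrt (real n + 1)" and "b = sqrt (real n)"
  have ab: "a * a = real n + 1" "b * b = real n" "a \<ge> 1" "b \<ge> 0" "b \<le> a"
    by (simp_all add: a_def b_def)
  have "1 = (a - b) * (a + b)" using ab by (simp add: algebra_simps)
  also have "\<dots> \<le> (a - b) * (2 * (a * a))"
    using ab mult_left_mono[of 1 a a] by (intro mult_left_mono) auto
  finally have "1 \<le> 2 * (a - b) * (real n + 1)" unfolding ab(1) by (simp only: mult_ac)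
  then show ?thesis by (simp only: pos_divide_le_eq a_def b_def)
qed

section \<open>Expectations along the process\<close>

lemma process_edges_cong:
  assumes "\<And>k. k < n \<Longrightarrow> u k = u' k" "\<And>k. k < n \<Longrightarrow> v k = v' k"
  shows "process_edges u v n = process_edges u' v' n"
  using assms by (induction n) auto

lemma process_edges_subset:
  assumes "\<And>k. u k \<le> k"
  shows "process_edges u v n \<subseteq> Pow {..n}"
proof (induction n)
  case (Suc n)
  have "neighbours (process_edges u v n) (u n) \<subseteq> {..n}"
    using Suc by (auto simp: neighbours_def)
  moreover have "Pow {..n} \<subseteq> Pow {..Suc n}" by auto
  ultimately show ?case using Suc assms[of n]
    by (fastforce simp: delete_edges_def duplicate_def)
qed simp

context uniform_choices
begin

definition graph :: "nat \<Rightarrow> 'a \<Rightarrow> nat set set" where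
  "graph n \<omega> = process_edges (\<lambda>k. U k \<omega>) (\<lambda>k. V k \<omega>) n"

lemma graph_Suc:
  "graph (Suc n) \<omega> = delete_edges (Suc n) (V n \<omega>) (duplicate (Suc n) (U n \<omega>) (graph n \<omega>))"
  by (simp add: graph_def)

lemma measurable_choices [measurable]:
  "U n \<in> M \<rightarrow>\<^sub>M count_space UNIV" "V n \<in> M \<rightarrow>\<^sub>M count_space UNIV"
  using indep_choices unfolding indep_vars_def
  by (metis UNIV_I old.sum.simps(5), metis UNIV_I old.sum.simps(6))

lemma AE_choices_le: "AE \<omega> in M. \<forall>n. U n \<omega> \<le> n \<and> V n \<omega> \<le> n"
proof -
  have "AE \<omega> in M. U n \<omega> \<le> n" for n
  proof (rule AE_distrD[OF measurable_choices(1)])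
    show "AE x in distr M (count_space UNIV) (U n). x \<le> n"
      unfolding distr_U by (simp add: AE_measure_pmf_iff set_pmf_of_set)
  qed
  moreover have "AE \<omega> in M. V n \<omega> \<le> n" for n
  proof (rule AE_distrD[OF measurable_choices(2)])
    show "AE x in distr M (count_space UNIV) (V n). x \<le> n"
      unfolding distr_V by (simp add: AE_measure_pmf_iff set_pmf_of_set)
  qed
  ultimately show ?thesis by (simp add: AE_all_countable)
qed

lemma prob_choice_eq:
  assumes "x \<le> n"
  shows "prob (U n -` {x} \<inter> space M) = 1 / (real n + 1)" "prob (V n -` {x} \<inter> space M) = 1 / (real n + 1)"
proof -
  have "measure (distr M (count_space UNIV) (U n)) {x} = 1 / (real n + 1)"
    using assms by (simp add: distr_U measure_pmf_single add.commute)
  then show "prob (U n -` {x} \<inter> space M) = 1 / (real n + 1)"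
    by (simp add: measure_distr)
  have "measure (distr M (count_space UNIV) (V n)) {x} = 1 / (real n + 1)"
    using assms by (simp add: distr_V measure_pmf_single add.commute)
  then show "prob (V n -` {x} \<inter> space M) = 1 / (real n + 1)"
    by (simp add: measure_distr)
qed

text \<open>The indices of the choices that determine the graph after \<open>n\<close> steps.\<close>
definition past :: "nat \<Rightarrow> (nat + nat) set" where
  "past n = Inl ` {..<n} \<union> Inr ` {..<n}"

lemma finite_past: "finite (past n)"
  by (simp add: past_def)

lemma graph_restrict:
  fixes n :: nat and \<omega> :: 'a
  defines "r \<equiv> restrict (\<lambda>i. case_sum U V i \<omega>) (past n)"
  shows "graph n \<omega> = process_edges (\<lambda>k. r (Inl k)) (\<lambda>k. r (Inr k)) n"
  unfolding graph_def r_def by (rule process_edges_cong) (auto simp: past_def)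

text \<open>
  Finitely many choices have countably many outcomes, so every function of them is measurable.
\<close>
lemma PiM_choices:
  assumes "finite A"
  shows "PiM A (\<lambda>_. count_space (UNIV :: nat set)) = count_space (PiE A (\<lambda>_. UNIV))"
  using assms by (intro count_space_PiM_finite) auto

lemma indep_past_present:
  "indep_var (count_space (PiE (past n) (\<lambda>_. UNIV))) (\<lambda>\<omega>. restrict (\<lambda>i. case_sum U V i \<omega>) (past n))
             (count_space (PiE {Inl n, Inr n} (\<lambda>_. UNIV))) (\<lambda>\<omega>. restrict (\<lambda>i. case_sum U V i \<omega>) {Inl n, Inr n})"
  using indep_var_restrict[OF indep_choices, of "past n" "{Inl n, Inr n}"]
  by (simp add: PiM_choices finite_past) (auto simp: past_def)

lemma measurable_graph [measurable]:
  "graph n \<in> M \<rightarrow>\<^sub>M count_space UNIV"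
proof -
  have "(\<lambda>\<omega>. restrict (\<lambda>i. case_sum U V i \<omega>) (past n)) \<in> M \<rightarrow>\<^sub>M count_space (PiE (past n) (\<lambda>_. UNIV))"
    using indep_past_present[of n] by (rule indep_var_rv1)
  then have "(\<lambda>r. process_edges (\<lambda>k. r (Inl k)) (\<lambda>k. r (Inr k)) n) \<circ> (\<lambda>\<omega>. restrict (\<lambda>i. case_sum U V i \<omega>) (past n))
      \<in> M \<rightarrow>\<^sub>M count_space UNIV"
    by (rule measurable_comp) simp
  then show ?thesis
    unfolding comp_def graph_restrict[symmetric] .
qed

lemma AE_graph_subset: "AE \<omega> in M. graph n \<omega> \<in> Pow (Pow {..n})"
  using AE_choices_le by eventually_elim (simp add: graph_def process_edges_subset)

text \<open>
  Almost surely the graph after \<open>n\<close> steps is one of finitely many, so functionals are bounded.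
\<close>
lemma integrable_graph:
  fixes F :: "nat set set \<Rightarrow> real"
  shows "integrable M (\<lambda>\<omega>. F (graph n \<omega>))"
proof (rule integrable_const_bound)
  show "AE \<omega> in M. norm (F (graph n \<omega>)) \<le> Max ((\<lambda>E. norm (F E)) ` Pow (Pow {..n}))"
    using AE_graph_subset[of n] by eventually_elim (rule Max_ge, auto)
qed (rule measurable_compose[OF measurable_graph], simp)

lemma measurable_step:
  fixes F :: "nat set set \<Rightarrow> nat \<Rightarrow> nat \<Rightarrow> real"
  shows "(\<lambda>\<omega>. F (graph n \<omega>) (U n \<omega>) (V n \<omega>)) \<in> borel_measurable M"
  by (rule measurable_compose_countable[OF _ measurable_choices(1)],
      rule measurable_compose_countable[OF _ measurable_choices(2)],
      rule measurable_compose[OF measurable_graph]) simp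

lemma expectation_graph_choice:
  fixes F :: "nat set set \<Rightarrow> real"
  assumes "x \<le> n" "y \<le> n"
  shows "expectation (\<lambda>\<omega>. F (graph n \<omega>) * of_bool (U n \<omega> = x \<and> V n \<omega> = y))
       = expectation (\<lambda>\<omega>. F (graph n \<omega>)) / (real n + 1)\<^sup>2"
proof -
  define X where "X = (\<lambda>r. F (process_edges (\<lambda>k. r (Inl k)) (\<lambda>k. r (Inr k)) n)) \<circ> (\<lambda>\<omega>. restrict (\<lambda>i. case_sum U V i \<omega>) (past n))"
  define Y where "Y = (\<lambda>r. of_bool (r (Inl n) = x \<and> r (Inr n) = y) :: real) \<circ> (\<lambda>\<omega>. restrict (\<lambda>i. case_sum U V i \<omega>) {Inl n, Inr n})"
  have ind: "indep_var borel X borel Y"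
    unfolding X_def Y_def by (rule indep_var_compose[OF indep_past_present]) auto
  have X: "X \<omega> = F (graph n \<omega>)" for \<omega>
    unfolding X_def comp_def graph_restrict[symmetric] ..
  have Y: "Y \<omega> = of_bool (U n \<omega> = x \<and> V n \<omega> = y)" for \<omega>
    by (simp add: Y_def)
  have XI: "integrable M X"
    unfolding X[abs_def] by (rule integrable_graph)
  have "Y \<in> borel_measurable M"
    using ind by (rule indep_var_rv2)
  then have YI: "integrable M Y"
    by (rule integrable_const_bound[where B=1, rotated]) (simp add: Y)
  have "expectation Y = prob {\<omega>\<in>space M. U n \<omega> = x \<and> V n \<omega> = y}"
  proof -
    have "expectation Y = expectation (indicator {\<omega>\<in>space M. U n \<omega> = x \<and> V n \<omega> = y})"
      by (rule Bochner_Integration.integral_cong) (auto simp: Y indicator_def)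
    then show ?thesis by simp
  qed
  also have "{\<omega>\<in>space M. U n \<omega> = x \<and> V n \<omega> = y}
      = (\<Inter>i\<in>{Inl n, Inr n}. case_sum U V i -` case_sum (\<lambda>_. {x}) (\<lambda>_. {y}) i \<inter> space M)"
    by auto
  also have "prob \<dots> = (\<Prod>i\<in>{Inl n, Inr n}. prob (case_sum U V i -` case_sum (\<lambda>_. {x}) (\<lambda>_. {y}) i \<inter> space M))"
    by (rule indep_varsD_finite[OF indep_vars_subset[OF indep_choices]]) auto
  also have "\<dots> = 1 / (real n + 1)\<^sup>2"
    using assms by (simp add: prob_choice_eq power2_eq_square)
  finally have EY: "expectation Y = 1 / (real n + 1)\<^sup>2" .
  have "expectation (\<lambda>\<omega>. X \<omega> * Y \<omega>) = expectation X * expectation Y"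
    by (rule indep_var_lebesgue_integral[OF ind XI YI])
  moreover have "X = (\<lambda>\<omega>. F (graph n \<omega>))" using X by blast
  ultimately show ?thesis by (simp add: X Y EY)
qed

text \<open>
  The two choices of a step are uniform and independent of the past, so in expectations they may be
  replaced by averages over all pairs.
\<close>
lemma
  fixes F :: "nat set set \<Rightarrow> nat \<Rightarrow> nat \<Rightarrow> real"
  shows integrable_step: "integrable M (\<lambda>\<omega>. F (graph n \<omega>) (U n \<omega>) (V n \<omega>))"
    and expectation_step: "expectation (\<lambda>\<omega>. F (graph n \<omega>) (U n \<omega>) (V n \<omega>))
       = expectation (\<lambda>\<omega>. \<Sum>x\<le>n. \<Sum>y\<le>n. F (graph n \<omega>) x y) / (real n + 1)\<^sup>2"
proof -
  let ?S = "\<lambda>\<omega>. \<Sum>x\<le>n. \<Sum>y\<le>n. F (graph n \<omega>) x y * of_bool (U n \<omega> = x \<and> V n \<omega> = y)"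
  have I: "integrable M (\<lambda>\<omega>. F (graph n \<omega>) x y * of_bool (U n \<omega> = x \<and> V n \<omega> = y))" for x y
    by (rule Bochner_Integration.integrable_bound[OF integrable_graph[of "\<lambda>E. F E x y" n] measurable_step]) auto
  have meas: "(\<lambda>\<omega>. F (graph n \<omega>) (U n \<omega>) (V n \<omega>)) \<in> borel_measurable M"
    by (rule measurable_step)
  have eq: "AE \<omega> in M. F (graph n \<omega>) (U n \<omega>) (V n \<omega>) = ?S \<omega>"
    using AE_choices_le
  proof eventually_elim
    case (elim \<omega>)
    have "?S \<omega> = (\<Sum>x\<le>n. \<Sum>y\<le>n. if U n \<omega> = x then if V n \<omega> = y then F (graph n \<omega>) x y else 0 else 0)"
      by (intro sum.cong refl) auto
    also have "\<dots> = (\<Sum>x\<le>n. if U n \<omega> = x then F (graph n \<omega>) x (V n \<omega>) else 0)"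
      using elim by (intro sum.cong refl) simp
    finally show ?case using elim by simp
  qed
  have SI: "integrable M ?S"
    by (intro Bochner_Integration.integrable_sum I)
  show int: "integrable M (\<lambda>\<omega>. F (graph n \<omega>) (U n \<omega>) (V n \<omega>))"
    using integrable_cong_AE[OF meas _ eq] SI by auto
  have "expectation (\<lambda>\<omega>. F (graph n \<omega>) (U n \<omega>) (V n \<omega>)) = expectation ?S"
    by (rule integral_cong_AE[OF meas _ eq]) (use SI in auto)
  also have "\<dots> = (\<Sum>x\<le>n. \<Sum>y\<le>n. expectation (\<lambda>\<omega>. F (graph n \<omega>) x y) / (real n + 1)\<^sup>2)"
    by (subst Bochner_Integration.integral_sum, intro Bochner_Integration.integrable_sum I,
        intro sum.cong refl, subst Bochner_Integration.integral_sum, rule I,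
        intro sum.cong refl, rule expectation_graph_choice) auto
  also have "\<dots> = expectation (\<lambda>\<omega>. \<Sum>x\<le>n. \<Sum>y\<le>n. F (graph n \<omega>) x y) / (real n + 1)\<^sup>2"
    by (subst Bochner_Integration.integral_sum, intro Bochner_Integration.integrable_sum integrable_graph,
        subst Bochner_Integration.integral_sum, rule integrable_graph)
       (simp add: sum_divide_distrib)
  finally show "expectation (\<lambda>\<omega>. F (graph n \<omega>) (U n \<omega>) (V n \<omega>))
       = expectation (\<lambda>\<omega>. \<Sum>x\<le>n. \<Sum>y\<le>n. F (graph n \<omega>) x y) / (real n + 1)\<^sup>2" .
qed

section \<open>Growth of degrees and of open triplets\<close>

lemma AE_duplication_deletion_step:
  "AE \<omega> in M. \<forall>n. duplication_deletion_step {..n} (graph n \<omega>) (Suc n) (U n \<omega>) (V n \<omega>)"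
  using AE_choices_le
proof eventually_elim
  case (elim \<omega>)
  have step: "duplication_deletion_step {..n} (graph n \<omega>) (Suc n) (U n \<omega>) (V n \<omega>)"
    if "simple_graph {..n} (graph n \<omega>)" for n
    using that elim by (simp add: duplication_deletion_step_def)
  have "simple_graph {..n} (graph n \<omega>)" for n
  proof (induction n)
    case 0
    show ?case by (simp add: graph_def simple_graph_def)
  next
    case (Suc n)
    from duplication_deletion_step.simple_step[OF step[OF Suc]]
    show ?case
      by (simp add: graph_Suc atMost_Suc)
  qed
  with step show ?case by blast
qed

lemma AE_simple_graph: "AE \<omega> in M. \<forall>n. simple_graph {..n} (graph n \<omega>)"
  using AE_duplication_deletion_step by eventually_elim (simp add: duplication_deletion_step_def)

text \<open>
  The common pattern of the recursions for the second moment of the degrees and for the number of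
  open triplets: a deterministic comparison for one step, averaged over the choices.
\<close>
lemma expectation_Suc_le:
  fixes Q :: "nat set \<Rightarrow> nat set set \<Rightarrow> real" and F :: "nat set set \<Rightarrow> nat \<Rightarrow> nat \<Rightarrow> real"
    and R :: "nat set set \<Rightarrow> real"
  assumes step: "\<And>E u v. duplication_deletion_step {..n} E (Suc n) u v \<Longrightarrow>
      Q {..Suc n} (delete_edges (Suc n) v (duplicate (Suc n) u E)) \<le> Q {..n} E + F E u v"
    and avg: "\<And>E. simple_graph {..n} E \<Longrightarrow> (\<Sum>u\<le>n. \<Sum>v\<le>n. F E u v) \<le> R E"
  shows "expectation (\<lambda>\<omega>. Q {..Suc n} (graph (Suc n) \<omega>))
    \<le> expectation (\<lambda>\<omega>. Q {..n} (graph n \<omega>)) + expectation (\<lambda>\<omega>. R (graph n \<omega>)) / (real n + 1)\<^sup>2"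
proof -
  have "expectation (\<lambda>\<omega>. Q {..Suc n} (graph (Suc n) \<omega>))
      \<le> expectation (\<lambda>\<omega>. Q {..n} (graph n \<omega>) + F (graph n \<omega>) (U n \<omega>) (V n \<omega>))"
  proof (rule integral_mono_AE)
    show "AE \<omega> in M. Q {..Suc n} (graph (Suc n) \<omega>) \<le> Q {..n} (graph n \<omega>) + F (graph n \<omega>) (U n \<omega>) (V n \<omega>)"
      using AE_duplication_deletion_step by eventually_elim (simp add: graph_Suc step)
  qed (intro integrable_graph Bochner_Integration.integrable_add integrable_step)+
  also have "\<dots> = expectation (\<lambda>\<omega>. Q {..n} (graph n \<omega>)) + expectation (\<lambda>\<omega>. F (graph n \<omega>) (U n \<omega>) (V n \<omega>))"
    by (intro Bochner_Integration.integral_add integrable_graph integrable_step)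
  also have "expectation (\<lambda>\<omega>. F (graph n \<omega>) (U n \<omega>) (V n \<omega>))
      = expectation (\<lambda>\<omega>. \<Sum>u\<le>n. \<Sum>v\<le>n. F (graph n \<omega>) u v) / (real n + 1)\<^sup>2"
    by (rule expectation_step)
  also have "expectation (\<lambda>\<omega>. \<Sum>u\<le>n. \<Sum>v\<le>n. F (graph n \<omega>) u v) \<le> expectation (\<lambda>\<omega>. R (graph n \<omega>))"
  proof (rule integral_mono_AE)
    show "AE \<omega> in M. (\<Sum>u\<le>n. \<Sum>v\<le>n. F (graph n \<omega>) u v) \<le> R (graph n \<omega>)"
      using AE_simple_graph by eventually_elim (simp add: avg)
  qed (rule integrable_graph)+
  finally show ?thesis by (simp add: divide_right_mono)
qed

text \<open>
  Duplication adds \<open>2 * (degree u + 1)\<close> and deletion removes \<open>2 * degree v\<close>; on average 2 is left.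
\<close>
lemma expectation_deg_sum: "expectation (\<lambda>\<omega>. deg_sum {..n} (graph n \<omega>)) = 2 * real n"
proof (induction n)
  case 0
  show ?case by (simp add: graph_def deg_sum_def degree_def neighbours_def)
next
  case (Suc n)
  let ?F = "\<lambda>E u v. 2 * (real (degree E u) + 1) - 2 * real (degree E v)"
  have "expectation (\<lambda>\<omega>. deg_sum {..Suc n} (graph (Suc n) \<omega>))
      = expectation (\<lambda>\<omega>. deg_sum {..n} (graph n \<omega>) + ?F (graph n \<omega>) (U n \<omega>) (V n \<omega>))"
  proof (rule integral_cong_AE)
    show "AE \<omega> in M. deg_sum {..Suc n} (graph (Suc n) \<omega>)
        = deg_sum {..n} (graph n \<omega>) + ?F (graph n \<omega>) (U n \<omega>) (V n \<omega>)"
      using AE_duplication_deletion_step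
    proof eventually_elim
      case (elim \<omega>)
      then show ?case
        using duplication_deletion_step.deg_sum_step[of "{..n}" "graph n \<omega>" "Suc n" "U n \<omega>" "V n \<omega>"]
        by (simp add: graph_Suc atMost_Suc)
    qed
  qed (intro borel_measurable_integrable Bochner_Integration.integrable_add
      integrable_graph integrable_step[where F="?F"])+
  also have "\<dots> = expectation (\<lambda>\<omega>. deg_sum {..n} (graph n \<omega>)) + expectation (\<lambda>\<omega>. ?F (graph n \<omega>) (U n \<omega>) (V n \<omega>))"
    by (intro Bochner_Integration.integral_add integrable_graph integrable_step[where F="?F"])
  also have "expectation (\<lambda>\<omega>. ?F (graph n \<omega>) (U n \<omega>) (V n \<omega>))
      = expectation (\<lambda>\<omega>. \<Sum>u\<le>n. \<Sum>v\<le>n. ?F (graph n \<omega>) u v) / (real n + 1)\<^sup>2"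
    by (rule expectation_step)
  also have "(\<lambda>\<omega>. \<Sum>u\<le>n. \<Sum>v\<le>n. ?F (graph n \<omega>) u v) = (\<lambda>\<omega>. 2 * (real n + 1)\<^sup>2)"
    unfolding sum_pairs_diff
    by (simp add: sum.distrib power2_eq_square algebra_simps flip: sum_distrib_left)
  finally show ?case using Suc by (simp add: prob_space)
qed

lemma expectation_deg_square_sum: "expectation (\<lambda>\<omega>. deg_square_sum {..n} (graph n \<omega>)) \<le> 14 * real n"
proof (induction n)
  case 0
  show ?case by (simp add: graph_def deg_square_sum_def degree_def neighbours_def)
next
  case (Suc n)
  have "expectation (\<lambda>\<omega>. deg_square_sum {..Suc n} (graph (Suc n) \<omega>))
    \<le> expectation (\<lambda>\<omega>. deg_square_sum {..n} (graph n \<omega>))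
      + expectation (\<lambda>\<omega>. (real n + 1) * (6 * deg_sum {..n} (graph n \<omega>) + 2 * (real n + 1))) / (real n + 1)\<^sup>2"
  proof (rule expectation_Suc_le[where F = deg_square_change])
    fix E u v assume "duplication_deletion_step {..n} E (Suc n) u v"
    from duplication_deletion_step.deg_square_sum_step[OF this]
    show "deg_square_sum {..Suc n} (delete_edges (Suc n) v (duplicate (Suc n) u E))
        \<le> deg_square_sum {..n} E + deg_square_change E u v"
      by (simp add: deg_square_change_def atMost_Suc)
  next
    fix E assume "simple_graph {..n} E"
    from sum_deg_square_change[OF this]
    show "(\<Sum>u\<le>n. \<Sum>v\<le>n. deg_square_change E u v) \<le> (real n + 1) * (6 * deg_sum {..n} E + 2 * (real n + 1))"
      by (simp add: add.commute)
  qed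
  also have "expectation (\<lambda>\<omega>. (real n + 1) * (6 * deg_sum {..n} (graph n \<omega>) + 2 * (real n + 1)))
      = (real n + 1) * (6 * (2 * real n) + 2 * (real n + 1))"
    using integrable_graph[of "deg_sum {..n}" n]
    by (simp add: expectation_deg_sum prob_space)
  also have "\<dots> \<le> 14 * (real n + 1)\<^sup>2" by (simp add: power2_eq_square algebra_simps)
  finally have "expectation (\<lambda>\<omega>. deg_square_sum {..Suc n} (graph (Suc n) \<omega>))
      \<le> expectation (\<lambda>\<omega>. deg_square_sum {..n} (graph n \<omega>)) + 14 * (real n + 1)\<^sup>2 / (real n + 1)\<^sup>2"
    by (simp add: divide_right_mono)
  then show ?case using Suc by simp
qed

lemma expectation_deg_moments:
  "expectation (\<lambda>\<omega>. deg_square_sum {..n} (graph n \<omega>) + deg_sum {..n} (graph n \<omega>)) \<le> 16 * real n"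
  using expectation_deg_square_sum[of n] by (simp add: integrable_graph expectation_deg_sum)

text \<open>
  The increments are at most \<open>32 / (n + 1)\<close>. Any bound below a power of \<open>n\<close> with exponent less
  than 1 serves the purpose; the square root is convenient because the harmonic sums telescope
  against it (\<open>inverse_le_sqrt_diff\<close>).
\<close>
lemma expectation_open_triplets: "expectation (\<lambda>\<omega>. real (card (open_triplets (graph n \<omega>)))) \<le> 64 * sqrt (real n)"
proof (induction n)
  case 0
  show ?case by (simp add: graph_def)
next
  case (Suc n)
  have "expectation (\<lambda>\<omega>. real (card (open_triplets (graph (Suc n) \<omega>))))
    \<le> expectation (\<lambda>\<omega>. real (card (open_triplets (graph n \<omega>))))
      + expectation (\<lambda>\<omega>. 2 * (deg_square_sum {..n} (graph n \<omega>) + deg_sum {..n} (graph n \<omega>))) / (real n + 1)\<^sup>2"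
  proof (rule expectation_Suc_le[where Q = "\<lambda>_ E. real (card (open_triplets E))"
        and F = "\<lambda>E u v. open_triplet_gain E u v - real (card (open_triplets_at E v))"])
    fix E u v assume "duplication_deletion_step {..n} E (Suc n) u v"
    from duplication_deletion_step.open_triplets_step[OF this]
    show "real (card (open_triplets (delete_edges (Suc n) v (duplicate (Suc n) u E))))
        \<le> real (card (open_triplets E)) + (open_triplet_gain E u v - real (card (open_triplets_at E v)))"
      by (simp add: open_triplet_gain_def)
  next
    fix E assume E: "simple_graph {..n} E"
    show "(\<Sum>u\<le>n. \<Sum>v\<le>n. open_triplet_gain E u v - real (card (open_triplets_at E v)))
        \<le> 2 * (deg_square_sum {..n} E + deg_sum {..n} E)"
      by (simp add: sum_subtractf sum_open_triplet_gain[OF E] sum_open_triplets_at[OF E] algebra_simps)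
  qed
  also have "expectation (\<lambda>\<omega>. 2 * (deg_square_sum {..n} (graph n \<omega>) + deg_sum {..n} (graph n \<omega>))) \<le> 32 * real n"
    unfolding integral_mult_right_zero using expectation_deg_moments[of n] by simp
  finally have "expectation (\<lambda>\<omega>. real (card (open_triplets (graph (Suc n) \<omega>))))
    \<le> expectation (\<lambda>\<omega>. real (card (open_triplets (graph n \<omega>)))) + 32 * real n / (real n + 1)\<^sup>2"
    by (simp add: divide_right_mono)
  also have "32 * real n / (real n + 1)\<^sup>2 \<le> 32 * (1 / (real n + 1))"
  proof -
    have "32 * real n / (real n + 1)\<^sup>2 \<le> 32 * (real n + 1) / (real n + 1)\<^sup>2"
      by (intro divide_right_mono) simp_all
    moreover have "32 * N / N\<^sup>2 = 32 * (1 / N)" for N :: real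
      by (simp add: power2_eq_square)
    ultimately show ?thesis by metis
  qed
  finally have "expectation (\<lambda>\<omega>. real (card (open_triplets (graph (Suc n) \<omega>))))
    \<le> expectation (\<lambda>\<omega>. real (card (open_triplets (graph n \<omega>)))) + 32 * (1 / (real n + 1))"
    by simp
  then show ?case using Suc inverse_le_sqrt_diff[of n] by (simp add: add.commute)
qed

text \<open>
  Every open triplet is duplicated through one of its three vertices, so the expected gain of a
  step is \<open>3 / (n + 1)\<close> times the number of open triplets, up to the moments of the degrees.
\<close>
lemma expectation_open_triplet_gain:
  "expectation (\<lambda>\<omega>. open_triplet_gain (graph n \<omega>) (U n \<omega>) (V n \<omega>)) / (real n + 1) \<le> 224 * (real n + 1) powr (-3/2)"
proof -
  define N where "N = real n + 1"
  have N: "N \<ge> 1" "N > 0" "sqrt N * sqrt N = N" "sqrt N \<ge> 1" "sqrt N > 0" by (simp_all add: N_def)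
  have "expectation (\<lambda>\<omega>. \<Sum>u\<le>n. \<Sum>v\<le>n. open_triplet_gain (graph n \<omega>) u v)
      = expectation (\<lambda>\<omega>. 3 * N * real (card (open_triplets (graph n \<omega>)))
          + 2 * (deg_square_sum {..n} (graph n \<omega>) + deg_sum {..n} (graph n \<omega>)))"
  proof (rule integral_cong_AE)
    show "AE \<omega> in M. (\<Sum>u\<le>n. \<Sum>v\<le>n. open_triplet_gain (graph n \<omega>) u v)
        = 3 * N * real (card (open_triplets (graph n \<omega>)))
          + 2 * (deg_square_sum {..n} (graph n \<omega>) + deg_sum {..n} (graph n \<omega>))"
      using AE_simple_graph
      by eventually_elim (simp add: sum_open_triplet_gain N_def add.commute)
  qed (rule borel_measurable_integrable, rule integrable_graph)+
  also have "\<dots> = expectation (\<lambda>\<omega>. 3 * N * real (card (open_triplets (graph n \<omega>))))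
      + expectation (\<lambda>\<omega>. 2 * (deg_square_sum {..n} (graph n \<omega>) + deg_sum {..n} (graph n \<omega>)))"
    by (intro Bochner_Integration.integral_add integrable_graph)
  also have "\<dots> \<le> 3 * N * (64 * sqrt N) + 32 * N"
  proof (rule add_mono)
    have "64 * sqrt (real n) \<le> 64 * sqrt N" by (simp add: N_def)
    then have "expectation (\<lambda>\<omega>. real (card (open_triplets (graph n \<omega>)))) \<le> 64 * sqrt N"
      using expectation_open_triplets[of n] by linarith
    then show "expectation (\<lambda>\<omega>. 3 * N * real (card (open_triplets (graph n \<omega>)))) \<le> 3 * N * (64 * sqrt N)"
      using N by simp
    show "expectation (\<lambda>\<omega>. 2 * (deg_square_sum {..n} (graph n \<omega>) + deg_sum {..n} (graph n \<omega>))) \<le> 32 * N"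
      unfolding integral_mult_right_zero using expectation_deg_moments[of n] by (simp add: N_def)
  qed
  also have "\<dots> \<le> 224 * (N * sqrt N)" using N by simp
  finally have "expectation (\<lambda>\<omega>. open_triplet_gain (graph n \<omega>) (U n \<omega>) (V n \<omega>)) / N \<le> 224 * (N * sqrt N) / N\<^sup>2 / N"
    unfolding expectation_step N_def[symmetric] using N by (intro divide_right_mono) auto
  also have "\<dots> = 224 * (sqrt N / N\<^sup>2)" using N by (simp add: power2_eq_square)
  also have "sqrt N / N\<^sup>2 = N powr (-3/2)"
    using N by (simp add: powr_half_sqrt[symmetric] powr_diff[symmetric] flip: powr_numeral)
  finally show ?thesis by (simp add: N_def)
qed

lemma open_triplet_gain_nonneg: "open_triplet_gain E u v \<ge> 0"
  by (simp add: open_triplet_gain_def)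

lemma AE_summable_open_triplet_gain:
  "AE \<omega> in M. summable (\<lambda>n. open_triplet_gain (graph n \<omega>) (U n \<omega>) (V n \<omega>) / (real n + 1))"
proof -
  let ?g = "\<lambda>n \<omega>. open_triplet_gain (graph n \<omega>) (U n \<omega>) (V n \<omega>) / (real n + 1)"
  have meas: "?g n \<in> borel_measurable M" for n
    using measurable_step[of open_triplet_gain n] by simp
  have int: "integrable M (?g n)" for n
    using integrable_step[of open_triplet_gain n] by simp
  have nn: "0 \<le> ?g n \<omega>" for n \<omega> by (simp add: open_triplet_gain_nonneg)
  have E: "(\<integral>\<^sup>+\<omega>. ennreal (?g n \<omega>) \<partial>M) \<le> ennreal (224 * real (Suc n) powr (-3/2))" for n
  proof -
    have "(\<integral>\<^sup>+\<omega>. ennreal (?g n \<omega>) \<partial>M) = ennreal (expectation (?g n))"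
      by (rule nn_integral_eq_integral[OF int]) (simp add: nn)
    also have "\<dots> \<le> ennreal (224 * real (Suc n) powr (-3/2))"
      using expectation_open_triplet_gain[of n] by (intro ennreal_leI) (simp add: add.commute)
    finally show ?thesis .
  qed
  have sm: "summable (\<lambda>n. 224 * real (Suc n) powr (-3/2))"
    using summable_real_powr_iff[of "-3/2"] by (intro summable_mult) (subst summable_Suc_iff, simp)
  have "(\<integral>\<^sup>+\<omega>. (\<Sum>n. ennreal (?g n \<omega>)) \<partial>M) = (\<Sum>n. \<integral>\<^sup>+\<omega>. ennreal (?g n \<omega>) \<partial>M)"
    using meas by (intro nn_integral_suminf) simp
  also have "\<dots> \<le> (\<Sum>n. ennreal (224 * real (Suc n) powr (-3/2)))"
    by (intro suminf_le E) auto
  also have "\<dots> = ennreal (\<Sum>n. 224 * real (Suc n) powr (-3/2))"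
    by (rule suminf_ennreal2[OF _ sm]) simp
  finally have "(\<integral>\<^sup>+\<omega>. (\<Sum>n. ennreal (?g n \<omega>)) \<partial>M) \<noteq> \<infinity>"
    by (metis ennreal_less_top infinity_ennreal_def leD)
  then have "AE \<omega> in M. (\<Sum>n. ennreal (?g n \<omega>)) \<noteq> \<infinity>"
    using meas by (intro nn_integral_PInf_AE) simp_all
  then show ?thesis
  proof eventually_elim
    case (elim \<omega>)
    then show ?case using nn by (intro summable_suminf_not_top) simp_all
  qed
qed

text \<open>
  Discarding the losses leaves a sum of nonnegative gains, to which Kronecker's lemma applies.
\<close>
lemma AE_open_triplets_sublinear:
  "AE \<omega> in M. (\<lambda>n. real (card (open_triplets (graph n \<omega>))) / (real n + 1)) \<longlonglongrightarrow> 0"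
  using AE_summable_open_triplet_gain AE_duplication_deletion_step
proof eventually_elim
  case (elim \<omega>)
  let ?a = "\<lambda>n. open_triplet_gain (graph n \<omega>) (U n \<omega>) (V n \<omega>)"
  have le: "real (card (open_triplets (graph n \<omega>))) \<le> (\<Sum>k<n. ?a k)" for n
  proof (induction n)
    case 0
    show ?case by (simp add: graph_def)
  next
    case (Suc n)
    have "real (card (open_triplets (graph (Suc n) \<omega>))) \<le> real (card (open_triplets (graph n \<omega>))) + ?a n"
      using duplication_deletion_step.open_triplets_step[of "{..n}" "graph n \<omega>" "Suc n" "U n \<omega>" "V n \<omega>"] elim(2)
      by (simp add: graph_Suc open_triplet_gain_def)
    then show ?case using Suc by simp
  qed
  have "(\<lambda>n. (\<Sum>k<n. ?a k) / (real n + 1)) \<longlonglongrightarrow> 0"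
    by (rule kronecker_nonneg[OF open_triplet_gain_nonneg elim(1)])
  then show ?case
    by (rule tendsto_sandwich[OF always_eventually always_eventually tendsto_const, rotated 2])
       (simp_all add: le divide_right_mono)
qed

text \<open>
  The expectations \<open>2 * n\<close> and at most \<open>14 * n\<close> of the two moments enter here; the cut-off 28 is
  chosen so that the quadratic term costs only \<open>n / 2\<close>.
\<close>
lemma expectation_large_degree:
  "real n / 2 - 1 \<le> 28 * expectation (\<lambda>\<omega>. real (card (large_degree {..n} (graph n \<omega>))))"
proof -
  have "2 * real n = expectation (\<lambda>\<omega>. deg_sum {..n} (graph n \<omega>))"
    by (simp add: expectation_deg_sum)
  also have "\<dots> \<le> expectation (\<lambda>\<omega>. real (card {..n}) + 28 * real (card (large_degree {..n} (graph n \<omega>)))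
      + deg_square_sum {..n} (graph n \<omega>) / 28)"
    by (intro integral_mono integrable_graph deg_sum_le_large_degree) simp_all
  also have "\<dots> = real (card {..n}) + 28 * expectation (\<lambda>\<omega>. real (card (large_degree {..n} (graph n \<omega>))))
      + expectation (\<lambda>\<omega>. deg_square_sum {..n} (graph n \<omega>)) / 28"
    using integrable_graph[of "\<lambda>E. real (card (large_degree {..n} E))" n] integrable_graph[of "deg_square_sum {..n}" n]
    by (simp add: prob_space)
  also have "\<dots> \<le> (real n + 1) + 28 * expectation (\<lambda>\<omega>. real (card (large_degree {..n} (graph n \<omega>)))) + real n / 2"
    using expectation_deg_square_sum[of n] by simp
  finally show ?thesis by simp
qed

text \<open>
  The proportion is bounded by 1, so its expectations converge to its almost sure limit as well,
  and they are bounded below by \<open>1 / 56\<close> asymptotically.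
\<close>
lemma large_degree_limit_pos:
  assumes "AE \<omega> in M. (\<lambda>n. real (card (large_degree {..n} (graph n \<omega>))) / (real n + 1)) \<longlonglongrightarrow> l"
  shows "l > 0"
proof -
  let ?m = "\<lambda>n \<omega>. real (card (large_degree {..n} (graph n \<omega>))) / (real n + 1)"
  have "(\<lambda>n. expectation (?m n)) \<longlonglongrightarrow> expectation (\<lambda>\<omega>. l)"
  proof (rule integral_dominated_convergence[where w = "\<lambda>_. 1"])
    show "AE \<omega> in M. norm (?m n \<omega>) \<le> 1" for n
    proof (rule AE_I2)
      fix \<omega>
      have "card (large_degree {..n} (graph n \<omega>)) \<le> card {..n}"
        by (rule card_mono) (auto simp: large_degree_def)
      then show "norm (?m n \<omega>) \<le> 1" by simp
    qed
    show "?m n \<in> borel_measurable M" for n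
      by (rule borel_measurable_integrable, rule integrable_graph)
  qed (use assms in simp_all)
  then have lim: "(\<lambda>n. expectation (?m n)) \<longlonglongrightarrow> l" by (simp add: prob_space)
  have "(\<lambda>n. (real n / 2 - 1) / (28 * (real n + 1))) \<longlonglongrightarrow> 1 / 56" by real_asymp
  moreover have "(real n / 2 - 1) / (28 * (real n + 1)) \<le> expectation (?m n)" for n
  proof -
    have "(real n / 2 - 1) / 28 \<le> expectation (\<lambda>\<omega>. real (card (large_degree {..n} (graph n \<omega>))))"
      using expectation_large_degree[of n] by simp
    from divide_right_mono[OF this, of "real n + 1"] show ?thesis by simp
  qed
  ultimately have "1 / 56 \<le> l"
    using lim by (intro LIMSEQ_le[of _ "1/56" _ l]) auto
  then show ?thesis by simp
qed

end

lemma card_large_degree: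
  "real (card (large_degree {..n} (process_edges u v n)))
     = real (n + 1) - real (degree_count u v n 0) - real (degree_count u v n 1)"
proof -
  let ?D = "\<lambda>d. {x \<in> {..n}. degree (process_edges u v n) x = d}"
  let ?L = "large_degree {..n} (process_edges u v n)"
  have "{..n} = ?L \<union> (?D 0 \<union> ?D 1)"
    unfolding large_degree_def by auto
  then have "n + 1 = card (?L \<union> (?D 0 \<union> ?D 1))"
    by (metis Suc_eq_plus1 card_atMost)
  also have "\<dots> = card ?L + (card (?D 0) + card (?D 1))"
    by (subst card_Un_disjoint, simp_all add: large_degree_def)
       (auto simp: card_Un_disjoint disjoint_iff)
  finally show ?thesis by (simp add: degree_count_def)
qed

theorem theorem4:
  fixes M :: "'a measure" and U V :: "nat \<Rightarrow> 'a \<Rightarrow> nat" and c :: "nat \<Rightarrow> real"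
  assumes "uniform_choices M U V"
    and "\<And>d. AE \<omega> in M.
           (\<lambda>n. real (degree_count (\<lambda>k. U k \<omega>) (\<lambda>k. V k \<omega>) n d) / real (n + 1)) \<longlonglongrightarrow> c d"
  shows "AE \<omega> in M.
           (\<lambda>n. global_clustering {..n} (process_edges (\<lambda>k. U k \<omega>) (\<lambda>k. V k \<omega>) n)) \<longlonglongrightarrow> 1 \<and>
           (\<lambda>n. average_clustering {..n} (process_edges (\<lambda>k. U k \<omega>) (\<lambda>k. V k \<omega>) n))
             \<longlonglongrightarrow> 1 - c 0 - c 1"
proof -
  interpret uniform_choices M U V by (rule assms(1))
  let ?m = "\<lambda>n \<omega>. real (card (large_degree {..n} (graph n \<omega>)))"
  let ?b = "\<lambda>n \<omega>. real (card (open_triplets (graph n \<omega>)))"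
  define l where "l = 1 - c 0 - c 1"
  have lim: "AE \<omega> in M. (\<lambda>n. ?m n \<omega> / (real n + 1)) \<longlonglongrightarrow> l"
    using assms(2)[of 0] assms(2)[of 1]
  proof eventually_elim
    case (elim \<omega>)
    let ?X = "\<lambda>d n. real (degree_count (\<lambda>k. U k \<omega>) (\<lambda>k. V k \<omega>) n d) / real (n + 1)"
    have "?m n \<omega> / (real n + 1) = 1 - ?X 0 n - ?X 1 n" for n
    proof -
      have "?m n \<omega> / (real n + 1) = (real (n + 1) - real (degree_count (\<lambda>k. U k \<omega>) (\<lambda>k. V k \<omega>) n 0)
          - real (degree_count (\<lambda>k. U k \<omega>) (\<lambda>k. V k \<omega>) n 1)) / real (n + 1)"
        unfolding graph_def card_large_degree by (simp add: add.commute)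
      then show ?thesis by (simp only: diff_divide_distrib) simp
    qed
    moreover have "(\<lambda>n. 1 - ?X 0 n - ?X 1 n) \<longlonglongrightarrow> l"
      unfolding l_def by (intro tendsto_diff tendsto_const elim)
    ultimately show ?case by simp
  qed
  have l: "l > 0" by (rule large_degree_limit_pos[OF lim])
  show ?thesis
    using lim AE_open_triplets_sublinear AE_simple_graph
  proof eventually_elim
    case (elim \<omega>)
    have ev: "\<forall>\<^sub>F n in sequentially. large_degree {..n} (graph n \<omega>) \<noteq> {}"
      using order_tendstoD(1)[OF elim(1) l] by eventually_elim auto
    have "(\<lambda>n. (?b n \<omega> / (real n + 1)) / (?m n \<omega> / (real n + 1))) \<longlonglongrightarrow> 0 / l"
      using elim l by (intro tendsto_divide) auto
    moreover have "(?b n \<omega> / (real n + 1)) / (?m n \<omega> / (real n + 1)) = ?b n \<omega> / ?m n \<omega>" for n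
    proof -
      have "real n + 1 \<noteq> 0" by linarith
      then show ?thesis by simp
    qed
    ultimately have bm: "(\<lambda>n. ?b n \<omega> / ?m n \<omega>) \<longlonglongrightarrow> 0" by simp
    have "(\<lambda>n. global_clustering {..n} (graph n \<omega>) - 1) \<longlonglongrightarrow> 0"
    proof (rule tendsto_0_le[OF bm, where K=1])
      show "\<forall>\<^sub>F n in sequentially. norm (global_clustering {..n} (graph n \<omega>) - 1) \<le> norm (?b n \<omega> / ?m n \<omega>) * 1"
        using ev by eventually_elim (use global_clustering_bounds elim(3) in auto)
    qed
    then have glob: "(\<lambda>n. global_clustering {..n} (graph n \<omega>)) \<longlonglongrightarrow> 1"
      by (simp add: LIM_zero_iff)
    have "(\<lambda>n. average_clustering {..n} (graph n \<omega>) - ?m n \<omega> / (real n + 1)) \<longlonglongrightarrow> 0"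
    proof (rule tendsto_0_le[OF elim(2), where K=1], rule always_eventually, rule allI)
      fix n
      show "norm (average_clustering {..n} (graph n \<omega>) - ?m n \<omega> / (real n + 1)) \<le> norm (?b n \<omega> / (real n + 1)) * 1"
        using average_clustering_bounds[of "{..n}" "graph n \<omega>"] elim(3) by (simp add: add.commute)
    qed
    from tendsto_add[OF this elim(1)]
    have "(\<lambda>n. average_clustering {..n} (graph n \<omega>)) \<longlonglongrightarrow> l" by simp
    with glob show ?case by (simp add: graph_def l_def)
  qed
qed

end
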